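(* Let $(x_k)$, $(g_k)$, $(d_k)$, $(w_k)$, $(\Delta_k)$, $(B_k)$, $(s_k)$ be generated by the ADAGB2 algorithm (defined in the context, with constants $\varsigma,\tau\in(0,1]$ and $\kappa_s\ge 1$) applied to the problem $\min_{x\in\mathcal F} f(x)$, $\mathcal F=\{x\in\mathbb R^n\mid l_i\le x_i\le u_i,\ i=1,\dots,n\}$. Write $G_k=\nabla f(x_k)$ and $\Xi_k=P_{\mathcal F}(x_k-G_k)-x_k$. Suppose that: (1) $f$ is twice continuously differentiable and $\mathcal F\neq\emptyset$; (2) there is $L\ge 0$ such that $\|\nabla f(x)-\nabla f(y)\|\le L\|x-y\|$ for all $x,y\in\mathbb R^n$; (3) there is $\kappa_B\ge 1$ such that $\|B_k\|\le\kappa_B$ for all $k\ge 0$; (4) there is a constant $f_{\rm low}<f(x_0)$ such that $f(x)\ge f_{\rm low}$ for all $x\in\mathcal F$; (5) there is $\kappa_{Gg}>0$ such that $\mathbb E_k\big[|(G_k-g_k)^Ts_k|\big]\le \kappa_{Gg}^2\,\mathbb E_k\big[\|s_k\|^2\big]$ for all $k\ge 0$; (6) there is $\kappa_{\rm err}\ge0$ such that, for all $k\ge0$, $\mathrm{RMSE}_k\le\kappa_{\rm err}\,\mathbb E_k[\|d_k\|]$, where $\mathrm{RMSE}_k=\sqrt{\mathbb E_k\big[\|g_k-G_k\|^2\big]}$. Then, for all $k\ge0$, $$\frac1{k+1}\sum_{j=0}^k\mathbb E\big[\|\Xi_j\|\big]\le\frac{(1+\kappa_{\rm err})\,\kappa_{\rm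 conv}}{\sqrt{k+1}},$$ where, with $\Gamma_0=f(x_0)-f_{\rm low}$ and $\kappa_*=\kappa_s^2\left(\kappa_{Gg}^2+\tfrac12(\kappa_B+L)\right)$, $$\kappa_{\rm conv}=\frac{4\kappa_B}{\tau\varsigma^2}\left\{1+\Gamma_0+2n\kappa_*\left[\log\left(\frac{8n\kappa_*\kappa_B}{\tau\varsigma^{5/2}}\right)-1\right]\right\}.$$
   Context: Problem and notation. $\|\cdot\|$ is the Euclidean norm (and the induced matrix norm). $l,u$ are vectors of bounds, with infinite entries allowed ($l_i=-\infty$, $u_i=+\infty$); $f$ is a real-valued function defined on an open set containing $\mathcal F$ (the Lipschitz hypothesis being stated on all of $\mathbb R^n$ presumes $\nabla f$ is defined there). For a nonempty closed box $S$, $P_S$ is the Euclidean projection onto $S$ (computed componentwise). $v_i$ or $v_{k,i}$ is the $i$-th component of $v$ or $v_k$. ADAGB2 algorithm. Inputs: deterministic $x_{\rm ini}\in\mathbb R^n$, $l$, $u$. Constants $\varsigma,\tau\in(0,1]$, $\kappa_s\ge1$. Set $x_0=P_{\mathcal F}(x_{\rm ini})$ and $w_{-1,i}=\sqrt{\varsigma}$ for all $i$. For $k=0,1,2,\dots$: Step 1. Obtain $g_k=g(x_k,\xi)$, a random approximation of $G_k=\nabla f(x_k)$ (no unbiasedness is assumed). Set $d_k=P_{\mathcal F}(x_k-g_k)-x_k$ and, for each $i$, $w_{k,i}=\sqrt{w_{k-1,i}^2+d_{k,i}^2}$, $\Delta_{k,i}=|d_{k,i}|/w_{k,i}$. Let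 $\mathcal B_k=\{x\in\mathbb R^n\mid |x_i-x_{k,i}|\le\Delta_{k,i},\ i=1,\dots,n\}$ and $s_k^L=P_{\mathcal F\cap\mathcal B_k}(x_k-g_k)-x_k$. Step 2. Choose a symmetric matrix $B_k\in\mathbb R^{n\times n}$ (an approximation of $\nabla^2 f(x_k)$; any symmetric matrix, including $0$, is allowed). Set $s_k^Q=\gamma_k s_k^L$, where $\gamma_k=\min\left[1,\frac{-g_k^Ts_k^L}{(s_k^L)^TB_ks_k^L}\right]$ if $(s_k^L)^TB_ks_k^L>0$ and $\gamma_k=1$ otherwise. Select any $s_k$ such that $x_k+s_k\in\mathcal F$, $|s_{k,i}|\le\kappa_s\Delta_{k,i}$ for all $i$, and $g_k^Ts_k+\frac12 s_k^TB_ks_k\le\tau\left(g_k^Ts_k^Q+\frac12(s_k^Q)^TB_ks_k^Q\right)$. Step 3. Set $x_{k+1}=x_k+s_k$. The algorithm generates a random process on a probability space. $\mathbb E_k[\cdot]$ denotes expectation conditioned on knowing $g_0,\dots,g_{k-1}$ (the past up to iteration $k$, by which $x_k$ is regarded as determined) and $\mathbb E[\cdot]$ the full expectation. All random quantities are assumed measurable and the expectations well defined; relations between conditional expectations hold almost surely. *)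

theory Defs
  imports "HOL-Probability.Probability"
begin

definition grad :: "('a::real_inner \<Rightarrow> real) \<Rightarrow> 'a \<Rightarrow> 'a" where
  "grad f x = (THE D. GDERIV f x :> D)"

definition twice_cont_diff_on :: "(real ^ 'n \<Rightarrow> real) \<Rightarrow> (real ^ 'n) set \<Rightarrow> bool" where
  "twice_cont_diff_on f U \<longleftrightarrow>
     (\<forall>x\<in>U. f differentiable (at x)) \<and>
     (\<exists>H :: real ^ 'n \<Rightarrow> real ^ 'n ^ 'n.
        (\<forall>x\<in>U. (grad f has_derivative (\<lambda>h. H x *v h)) (at x)) \<and> continuous_on U H)"

definition box_set :: "ereal ^ 'n \<Rightarrow> ereal ^ 'n \<Rightarrow> (real ^ 'n) set" where
  "box_set l u = {x. \<forall>i. l $ i \<le> ereal (x $ i) \<and> ereal (x $ i) \<le> u $ i}"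

definition trust_region :: "real ^ 'n \<Rightarrow> real ^ 'n \<Rightarrow> (real ^ 'n) set" where
  "trust_region c \<Delta> = {x. \<forall>i. \<bar>x $ i - c $ i\<bar> \<le> \<Delta> $ i}"

definition quad_model :: "real ^ 'n \<Rightarrow> real ^ 'n ^ 'n \<Rightarrow> real ^ 'n \<Rightarrow> real" where
  "quad_model g B s = g \<bullet> s + 1/2 * (s \<bullet> (B *v s))"

definition linear_step ::
  "(real ^ 'n) set \<Rightarrow> real ^ 'n \<Rightarrow> real ^ 'n \<Rightarrow> real ^ 'n \<Rightarrow> real ^ 'n" where
  "linear_step F x g \<Delta> = closest_point (F \<inter> trust_region x \<Delta>) (x - g) - x"

definition quad_step :: "real ^ 'n \<Rightarrow> real ^ 'n ^ 'n \<Rightarrow> real ^ 'n \<Rightarrow> real ^ 'n" where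
  "quad_step g B sL =
     (if sL \<bullet> (B *v sL) > 0 then min 1 (- (g \<bullet> sL) / (sL \<bullet> (B *v sL))) else 1) *\<^sub>R sL"

text \<open>One realisation of the algorithm. The gradient approximations \<open>g\<close>, the matrices \<open>B\<close> and
  the steps \<open>s\<close> are otherwise arbitrary. The weight with index \<open>-1\<close> is the zero case of the
  \<open>case\<close> expression. The constant called varsigma in the literature is \<open>\<sigma>\<close> here.\<close>

definition adagb2_run ::
  "ereal ^ 'n \<Rightarrow> ereal ^ 'n \<Rightarrow> real \<Rightarrow> real \<Rightarrow> real \<Rightarrow> real ^ 'n \<Rightarrow>
   (nat \<Rightarrow> real ^ 'n) \<Rightarrow> (nat \<Rightarrow> real ^ 'n) \<Rightarrow> (nat \<Rightarrow> real ^ 'n) \<Rightarrow> (nat \<Rightarrow> real ^ 'n) \<Rightarrow>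
   (nat \<Rightarrow> real ^ 'n) \<Rightarrow> (nat \<Rightarrow> real ^ 'n ^ 'n) \<Rightarrow> (nat \<Rightarrow> real ^ 'n) \<Rightarrow> bool" where
  "adagb2_run l u \<sigma> \<tau> \<kappa>s x_ini x g d w \<Delta> B s \<longleftrightarrow>
     x 0 = closest_point (box_set l u) x_ini \<and>
     (\<forall>k.
        d k = closest_point (box_set l u) (x k - g k) - x k \<and>
        (\<forall>i. w k $ i =
           sqrt ((case k of 0 \<Rightarrow> sqrt \<sigma> | Suc j \<Rightarrow> w j $ i)\<^sup>2 + (d k $ i)\<^sup>2)) \<and>
        (\<forall>i. \<Delta> k $ i = \<bar>d k $ i\<bar> / w k $ i) \<and>
        transpose (B k) = B k \<and>
        x k + s k \<in> box_set l u \<and>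
        (\<forall>i. \<bar>s k $ i\<bar> \<le> \<kappa>s * \<Delta> k $ i) \<and>
        quad_model (g k) (B k) (s k)
          \<le> \<tau> * quad_model (g k) (B k)
                 (quad_step (g k) (B k) (linear_step (box_set l u) (x k) (g k) (\<Delta> k))) \<and>
        x (Suc k) = x k + s k)"

text \<open>The \<open>\<sigma>\<close>-algebra generated by \<open>g 0, \<dots>, g (k - 1)\<close>; it is trivial for \<open>k = 0\<close>.\<close>

definition past :: "'w measure \<Rightarrow> (nat \<Rightarrow> 'w \<Rightarrow> real ^ 'n) \<Rightarrow> nat \<Rightarrow> 'w measure" where
  "past M g k = sigma (space M) {g j -` A \<inter> space M | j A. j < k \<and> A \<in> sets borel}"

text \<open>Conditional expectation of a nonnegative random variable, with values in \<open>[0, \<infinity>]\<close>, so that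
  it is meaningful without integrability.\<close>

definition cond_E ::
  "'w measure \<Rightarrow> (nat \<Rightarrow> 'w \<Rightarrow> real ^ 'n) \<Rightarrow> nat \<Rightarrow> ('w \<Rightarrow> real) \<Rightarrow> 'w \<Rightarrow> ennreal" where
  "cond_E M g k X = nn_cond_exp M (past M g k) (\<lambda>\<omega>. ennreal (X \<omega>))"

definition ennreal_sqrt :: "ennreal \<Rightarrow> ennreal" where
  "ennreal_sqrt a = (if a = \<infinity> then \<infinity> else ennreal (sqrt (enn2real a)))"

definition RMSE ::
  "'w measure \<Rightarrow> (nat \<Rightarrow> 'w \<Rightarrow> real ^ 'n) \<Rightarrow> (nat \<Rightarrow> 'w \<Rightarrow> real ^ 'n) \<Rightarrow> nat \<Rightarrow> 'w \<Rightarrow> ennreal" where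
  "RMSE M g G k \<omega> = ennreal_sqrt (cond_E M g k (\<lambda>\<omega>'. (norm (g k \<omega>' - G k \<omega>'))\<^sup>2) \<omega>)"

definition kappa_star :: "real \<Rightarrow> real \<Rightarrow> real \<Rightarrow> real \<Rightarrow> real" where
  "kappa_star \<kappa>s \<kappa>Gg \<kappa>B L = \<kappa>s\<^sup>2 * (\<kappa>Gg\<^sup>2 + 1/2 * (\<kappa>B + L))"

definition kappa_conv :: "real \<Rightarrow> real \<Rightarrow> real \<Rightarrow> real \<Rightarrow> real \<Rightarrow> real \<Rightarrow> real" where
  "kappa_conv n \<sigma> \<tau> \<kappa>B \<kappa>star \<Gamma>0 =
     4 * \<kappa>B / (\<tau> * \<sigma>\<^sup>2) *
       (1 + \<Gamma>0 + 2 * n * \<kappa>star * (ln (8 * n * \<kappa>star * \<kappa>B / (\<tau> * \<sigma> powr (5/2))) - 1))"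

end

theory Submission
  imports Defs
begin

text \<open>
The proof balances two sums that are governed by the same weights. In one step, the objective
decreases by a multiple of \<open>gain k\<close>, the sum of \<open>(d k $ i)\<^sup>2 / w k $ i\<close> over the coordinates \<open>i\<close>, up to
errors of the size of the squared step length (\<open>step_decrease\<close>). The errors are the second-order
terms of the Taylor bound and of the quadratic model and, in expectation, the error of the gradient
approximation along the step. The trust region bounds the squared step length by a multiple of
\<open>radius_sq k\<close>, the sum of \<open>(d k $ i)\<^sup>2 / (w k $ i)\<^sup>2\<close>. Taking expectations and telescoping therefore
gives (\<open>expectation_total_gain\<close>)

  \<open>rate * (sum of expected gains) \<le> \<Gamma>0 + \<kappa>star * (sum of expected squared radii)\<close>.

Both sums are compared with the last weights. Since \<open>(w k $ i)\<^sup>2\<close> accumulates the squares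
\<open>(d j $ i)\<^sup>2\<close>, the sum of the gains is at least the sum of the weights, up to their initial values
(\<open>adagrad_weights.w_le\<close>), whereas the sum of the squared radii is at most logarithmic in the weights
(\<open>adagrad_weights.sum_ratio_le_ln\<close>). Hence the expected weights are bounded independently of \<open>k\<close>.
The logarithm is estimated by a tangent, whose slope is chosen such that half of the left-hand side
survives; this gives the constant \<open>kappa_conv\<close> (\<open>expectation_weight_sum_le\<close>).

By Cauchy-Schwarz, the sum of the norms of \<open>d 0, \<dots>, d k\<close> is at most \<open>sqrt (k + 1)\<close> times the sum of
the weights, which is the rate for the computed projected gradients. Projections being nonexpansive,
the exact projected gradient exceeds the computed one by at most the gradient error, whose mean is
bounded through its conditional root mean square (\<open>nn_integral_le_conditional_rms\<close>).
\<close>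

section \<open>Projections onto products of intervals\<close>

lemma closed_convex_ereal_interval:
  fixes a b :: ereal
  shows "closed {t. a \<le> ereal t \<and> ereal t \<le> b}" (is "closed ?T")
    and "convex {t. a \<le> ereal t \<and> ereal t \<le> b}"
proof -
  show "closed ?T"
    by (intro closed_Collect_conj closed_Collect_le continuous_intros)
  have "is_interval ?T"
    unfolding is_interval_1 by (auto intro: order_trans[of _ "ereal _"])
  then show "convex ?T"
    by (rule is_interval_convex)
qed

lemma closed_convex_product_set:
  fixes T :: "'n::finite \<Rightarrow> 'a::real_normed_vector set"
  shows "(\<And>i. closed (T i)) \<Longrightarrow> closed {y :: 'a ^ 'n. \<forall>i. y $ i \<in> T i}"
    and "(\<And>i. convex (T i)) \<Longrightarrow> convex {y :: 'a ^ 'n. \<forall>i. y $ i \<in> T i}"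
proof -
  assume closed: "\<And>i. closed (T i)"
  show "closed {y :: 'a ^ 'n. \<forall>i. y $ i \<in> T i}"
    using continuous_closed_vimage[OF closed, of "\<lambda>y. y $ i" for i]
    by (intro closed_Collect_all) (simp add: vimage_def)
next
  assume "\<And>i. convex (T i)"
  then show "convex {y :: 'a ^ 'n. \<forall>i. y $ i \<in> T i}"
    by (simp add: convex_def)
qed

lemma box_set_eq: "box_set l u = {y. \<forall>i. y $ i \<in> {t. l $ i \<le> ereal t \<and> ereal t \<le> u $ i}}"
  by (simp add: box_set_def)

lemma closed_convex_box_set: "closed (box_set l u)" "convex (box_set l u)"
  unfolding box_set_eq
  by (intro closed_convex_product_set closed_convex_ereal_interval)+

text \<open>The variational inequality of a projection decouples over the coordinates of a product set: it is
tested with a point that differs from the projection in one coordinate only. All that is used about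
the two projections of the algorithm, onto the box and onto its intersection with the trust region,
is this one-dimensional inequality.\<close>

lemma closest_point_product_set:
  fixes T :: "'n::finite \<Rightarrow> real set" and z :: "real ^ 'n"
  assumes closed: "\<And>i. closed (T i)" and convex: "\<And>i. convex (T i)"
    and y: "\<And>i. y $ i \<in> T i"
  defines "p \<equiv> closest_point {y. \<forall>i. y $ i \<in> T i} z"
  shows "p $ i \<in> T i" and "t \<in> T i \<Longrightarrow> (z $ i - p $ i) * (t - p $ i) \<le> 0"
proof -
  let ?C = "{y. \<forall>i. y $ i \<in> T i}"
  have C: "closed ?C" "convex ?C"
    using closed convex by (blast intro: closed_convex_product_set)+
  have p: "p \<in> ?C"
    unfolding p_def using C(1) y by (intro closest_point_in_set) auto
  then show "p $ i \<in> T i"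
    by simp
  assume "t \<in> T i"
  then have "p + axis i (t - p $ i) \<in> ?C"
    using p by (auto simp: axis_def)
  with C have "(z - p) \<bullet> (p + axis i (t - p $ i) - p) \<le> 0"
    unfolding p_def by (intro closest_point_dot)
  then show "(z $ i - p $ i) * (t - p $ i) \<le> 0"
    by (simp add: inner_axis)
qed

text \<open>One coordinate of the linear step. Here \<open>\<gamma>\<close> is the slope, \<open>d\<close> the full projected
displacement, \<open>\<mu> * d\<close> a truncation of it that stays within the trust region, and \<open>s\<close> the
displacement projected onto the smaller set. Say \<open>0 < d\<close>; the other sign is symmetric. The first
hypothesis gives \<open>d \<le> - \<gamma>\<close>. Then \<open>s\<close> reaches at least as far as \<open>\<mu> * d\<close>, since otherwise the second
hypothesis would force \<open>- \<gamma>\<close> to be smaller than \<open>d\<close>. For \<open>d = 0\<close> the last hypothesis is the claim.\<close>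

lemma truncated_projection_decrease:
  fixes \<gamma> d s \<mu> :: real
  assumes full: "(\<gamma> + d) * d \<le> 0" and trunc: "(\<gamma> + s) * (s - \<mu> * d) \<le> 0"
    and "0 < \<mu>" "\<mu> \<le> 1" and self: "\<gamma> * s + s\<^sup>2 \<le> 0"
  shows "\<mu> * d\<^sup>2 \<le> - (\<gamma> * s)"
proof -
  have pos: "\<mu> * d\<^sup>2 \<le> - (\<gamma> * s)"
    if full: "(\<gamma> + d) * d \<le> 0" and trunc: "(\<gamma> + s) * (s - \<mu> * d) \<le> 0" and "0 < d"
      and self: "\<gamma> * s + s\<^sup>2 \<le> 0"
    for \<gamma> d s :: real
  proof -
    have \<gamma>: "\<gamma> \<le> - d"
      using full \<open>0 < d\<close> by (simp add: mult_le_0_iff)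
    have "\<mu> * d \<le> d"
      using \<open>0 < d\<close> \<open>\<mu> \<le> 1\<close> by simp
    then have s: "\<mu> * d \<le> s"
      using trunc \<gamma> by (auto simp: mult_le_0_iff)
    have "\<mu> * d\<^sup>2 = (\<mu> * d) * d"
      by (simp add: power2_eq_square)
    also have "\<dots> \<le> s * (- \<gamma>)"
      using s \<gamma> \<open>0 < d\<close> \<open>0 < \<mu>\<close> by (intro mult_mono) (auto intro: order_trans[rotated])
    finally show ?thesis
      by (simp add: mult.commute)
  qed
  consider "0 < d" | "d = 0" | "0 < - d"
    by linarith
  then show ?thesis
  proof cases
    case 1
    then show ?thesis
      using pos full trunc self by blast
  next
    case 2
    then show ?thesis
      using order_trans[OF _ self, of "\<gamma> * s"] by simp
  next
    case 3
    have "(- \<gamma> + - s) * (- s - \<mu> * (- d)) = (\<gamma> + s) * (s - \<mu> * d)"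
      by (simp add: algebra_simps)
    with 3 show ?thesis
      using pos[of "- \<gamma>" "- d" "- s"] full trunc self by (simp add: algebra_simps)
  qed
qed

lemma norm_square_vec: "(norm v)\<^sup>2 = (\<Sum>i\<in>UNIV. (v $ i)\<^sup>2)" for v :: "real ^ 'n"
  by (simp add: norm_vec_def L2_set_def sum_nonneg)

text \<open>The first bound, decrease against step length, controls the curvature term of the quadratic model;
the second one, decrease against the weighted projected gradient, is what enters the complexity
bound. A lower bound \<open>\<mu> \<le> 1\<close> of the weights makes \<open>\<mu> / w $ i\<close> an admissible truncation factor in
coordinate \<open>i\<close>, even where the trust region is wider than the projected gradient.\<close>

lemma linear_step_decrease:
  fixes x g :: "real ^ 'n" and l u :: "ereal ^ 'n"
  defines "d \<equiv> closest_point (box_set l u) (x - g) - x"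
  assumes x: "x \<in> box_set l u"
    and w: "\<And>i. \<mu> \<le> w $ i" "0 < \<mu>" "\<mu> \<le> 1" and \<Delta>: "\<And>i. \<Delta> $ i = \<bar>d $ i\<bar> / w $ i"
  defines "sL \<equiv> linear_step (box_set l u) x g \<Delta>"
  shows "(norm sL)\<^sup>2 \<le> - (g \<bullet> sL)" and "\<mu> * (\<Sum>i\<in>UNIV. (d $ i)\<^sup>2 / w $ i) \<le> - (g \<bullet> sL)"
proof -
  define I where "I i = {t. l $ i \<le> ereal t \<and> ereal t \<le> u $ i}" for i
  define J where "J i = I i \<inter> {x $ i - \<Delta> $ i .. x $ i + \<Delta> $ i}" for i
  have closed_convex: "closed (I i)" "convex (I i)" "closed (J i)" "convex (J i)" for i
    using closed_convex_ereal_interval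
    by (auto simp: I_def J_def intro!: convex_Int closed_Int)
  have w_pos: "0 < w $ i" for i
    using w(1)[of i] \<open>0 < \<mu>\<close> by linarith
  have \<Delta>_nonneg: "0 \<le> \<Delta> $ i" for i
    using w_pos[of i] by (simp add: \<Delta>)
  have x_I: "x $ i \<in> I i" for i
    using x by (simp add: box_set_def I_def)
  have x_J: "x $ i \<in> J i" for i
    using x_I[of i] \<Delta>_nonneg[of i] by (simp add: J_def)
  have d_eq: "d = closest_point {y. \<forall>i. y $ i \<in> I i} (x - g) - x"
    by (simp add: d_def box_set_def I_def)
  have "box_set l u \<inter> trust_region x \<Delta> = {y. \<forall>i. y $ i \<in> J i}"
    by (auto simp: box_set_def trust_region_def I_def J_def abs_le_iff algebra_simps)
  then have sL_eq: "sL = closest_point {y. \<forall>i. y $ i \<in> J i} (x - g) - x"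
    by (simp add: sL_def linear_step_def)
  have xd: "x $ i + d $ i \<in> I i" for i
    using closest_point_product_set(1)[of I x "x - g" i] closed_convex x_I by (simp add: d_eq)
  have d: "(- g $ i - d $ i) * (t - x $ i - d $ i) \<le> 0" if "t \<in> I i" for i t
    using closest_point_product_set(2)[of I x t i "x - g"] closed_convex x_I that
    by (simp add: d_eq algebra_simps)
  have s: "(- g $ i - sL $ i) * (t - x $ i - sL $ i) \<le> 0" if "t \<in> J i" for i t
    using closest_point_product_set(2)[of J x t i "x - g"] closed_convex x_J that
    by (simp add: sL_eq algebra_simps)
  have self: "g $ i * sL $ i + (sL $ i)\<^sup>2 \<le> 0" for i
    using s[OF x_J[of i]] by (simp add: algebra_simps power2_eq_square)
  have "(norm sL)\<^sup>2 = (\<Sum>i\<in>UNIV. (sL $ i)\<^sup>2)"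
    by (rule norm_square_vec)
  also have "\<dots> \<le> (\<Sum>i\<in>UNIV. - (g $ i * sL $ i))"
  proof (rule sum_mono)
    fix i
    show "(sL $ i)\<^sup>2 \<le> - (g $ i * sL $ i)"
      using self[of i] by linarith
  qed
  finally show "(norm sL)\<^sup>2 \<le> - (g \<bullet> sL)"
    by (simp add: inner_vec_def sum_negf)
  have "\<mu> * ((d $ i)\<^sup>2 / w $ i) \<le> - (g $ i * sL $ i)" for i
  proof -
    define m where "m = \<mu> / w $ i"
    have m: "0 < m" "m \<le> 1" "m * \<bar>d $ i\<bar> \<le> \<Delta> $ i"
      using w(1)[of i] w_pos[of i] \<open>0 < \<mu>\<close> \<open>\<mu> \<le> 1\<close>
      by (auto simp: m_def \<Delta> divide_simps mult_left_le_one_le)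
    \<comment> \<open>The point of the segment from \<open>x\<close> to its projection that lies in the trust region.\<close>
    have "x $ i + m * d $ i = (1 - m) * x $ i + m * (x $ i + d $ i)"
      by (simp add: algebra_simps)
    also have "\<dots> \<in> I i"
      using convexD[OF closed_convex(2) x_I xd, of "1 - m" m] m by simp
    finally have "x $ i + m * d $ i \<in> J i"
      using m abs_le_iff[of "m * d $ i" "\<Delta> $ i"] by (simp add: J_def abs_mult)
    from s[OF this] have "(g $ i + sL $ i) * (sL $ i - m * d $ i) \<le> 0"
      by (simp add: algebra_simps)
    moreover have "(g $ i + d $ i) * d $ i \<le> 0"
      using d[OF x_I[of i]] by (simp add: algebra_simps)
    ultimately have "m * (d $ i)\<^sup>2 \<le> - (g $ i * sL $ i)"
      using truncated_projection_decrease m self by blast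
    then show ?thesis
      by (simp add: m_def)
  qed
  then show "\<mu> * (\<Sum>i\<in>UNIV. (d $ i)\<^sup>2 / w $ i) \<le> - (g \<bullet> sL)"
    by (simp add: inner_vec_def sum_distrib_left sum_negf[symmetric] sum_mono)
qed

section \<open>Decrease of the objective in one step\<close>

lemma quadratic_form_bound:
  fixes B :: "real ^ 'n ^ 'n"
  assumes "onorm ((*v) B) \<le> \<kappa>"
  shows "\<bar>s \<bullet> (B *v s)\<bar> \<le> \<kappa> * (norm s)\<^sup>2"
proof -
  have "\<bar>s \<bullet> (B *v s)\<bar> \<le> norm s * norm (B *v s)"
    by (rule Cauchy_Schwarz_ineq2)
  also have "\<dots> \<le> norm s * (\<kappa> * norm s)"
  proof (rule mult_left_mono)
    have "norm (B *v s) \<le> onorm ((*v) B) * norm s"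
      by (rule onorm) simp
    also have "\<dots> \<le> \<kappa> * norm s"
      using assms by (rule mult_right_mono) simp
    finally show "norm (B *v s) \<le> \<kappa> * norm s" .
  qed simp
  finally show ?thesis
    by (simp add: power2_eq_square mult.left_commute)
qed

text \<open>The scaling factor of the step minimises the model along \<open>sL\<close> up to the full step. A full step
keeps at least half of the linear decrease \<open>a = - (g \<bullet> sL)\<close>. A shorter step keeps \<open>a\<^sup>2 / (2 * b)\<close>, where the
curvature \<open>b\<close> is at most \<open>\<kappa> * a\<close> because the squared step length is at most \<open>a\<close>.\<close>

lemma quad_model_quad_step:
  fixes B :: "real ^ 'n ^ 'n"
  assumes B: "onorm ((*v) B) \<le> \<kappa>" and "1 \<le> \<kappa>" and sL: "(norm sL)\<^sup>2 \<le> - (g \<bullet> sL)"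
  shows "quad_model g B (quad_step g B sL) \<le> g \<bullet> sL / (2 * \<kappa>)"
proof -
  define a where "a = - (g \<bullet> sL)"
  define b where "b = sL \<bullet> (B *v sL)"
  define c where "c = (if b > 0 then min 1 (a / b) else 1)"
  have a: "0 \<le> a"
    using sL zero_le_power2[of "norm sL"] by (simp only: a_def)
  have "a / (2 * \<kappa>) \<le> a / 2"
    using a \<open>1 \<le> \<kappa>\<close> by (intro divide_left_mono) auto
  have b: "b \<le> \<kappa> * a"
  proof -
    have "b \<le> \<kappa> * (norm sL)\<^sup>2"
      using quadratic_form_bound[OF B, of sL] by (simp add: b_def)
    also have "\<dots> \<le> \<kappa> * a"
      using sL \<open>1 \<le> \<kappa>\<close> by (intro mult_left_mono) (auto simp: a_def)
    finally show ?thesis .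
  qed
  have "quad_model g B (quad_step g B sL) = - c * a + 1/2 * c\<^sup>2 * b"
    by (simp add: quad_model_def quad_step_def a_def b_def c_def matrix_vector_mult_scaleR
        power2_eq_square)
  also have "\<dots> \<le> - (a / (2 * \<kappa>))"
  proof (cases "0 < b \<and> a < b")
    case True
    then have "c = a / b"
      by (simp add: c_def)
    then have "- c * a + 1/2 * c\<^sup>2 * b = - (a * (a / (2 * b)))"
      using True by (simp add: power2_eq_square)
    also have "\<dots> \<le> - (a * (1 / (2 * \<kappa>)))"
    proof -
      have "1 / (2 * \<kappa>) \<le> a / (2 * b)"
        using True b \<open>1 \<le> \<kappa>\<close> by (simp add: field_simps)
      then show ?thesis
        using a by (simp add: mult_left_mono del: times_divide_eq_right)
    qed
    finally show ?thesis
      by simp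
  next
    case False
    then have "c = 1"
      by (auto simp: c_def)
    moreover have "b \<le> a"
      using False a by linarith
    ultimately show ?thesis
      using \<open>a / (2 * \<kappa>) \<le> a / 2\<close> by simp
  qed
  finally show ?thesis
    by (simp add: a_def)
qed

text \<open>As \<open>grad\<close> is a definite description, a gradient has to exist and to be unique: the derivative is
represented by the vector of its values on the basis.\<close>

lemma GDERIV_grad:
  assumes "f differentiable (at x)"
  shows "GDERIV f x :> grad f (x :: real ^ 'n)"
proof -
  obtain D where D: "(f has_derivative D) (at x)"
    using assms by (auto simp: differentiable_def)
  define v where "v = (\<Sum>i\<in>Basis. D i *\<^sub>R i)"
  have "D = (\<lambda>h. h \<bullet> v)"
  proof
    fix h
    have "D h = D (\<Sum>i\<in>Basis. (h \<bullet> i) *\<^sub>R i)"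
      by (simp add: euclidean_representation)
    also have "\<dots> = (\<Sum>i\<in>Basis. (h \<bullet> i) * D i)"
      using has_derivative_linear[OF D] by (simp add: linear_sum linear_cmul)
    also have "\<dots> = h \<bullet> v"
      by (simp add: v_def inner_sum_right mult.commute)
    finally show "D h = h \<bullet> v" .
  qed
  then have ex: "GDERIV f x :> v"
    using D by (simp add: gderiv_def)
  have uniq: "v' = v" if "GDERIV f x :> v'" for v'
  proof -
    have "(\<lambda>h. h \<bullet> v') = (\<lambda>h. h \<bullet> v)"
      using that ex unfolding gderiv_def by (rule has_derivative_unique)
    from fun_cong[OF this, of "v' - v"] have "(v' - v) \<bullet> (v' - v) = 0"
      by (simp only: inner_diff_right diff_self)
    then show ?thesis
      by simp
  qed
  show ?thesis
    unfolding grad_def using ex uniq by (rule theI)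
qed

lemma descent_lemma:
  fixes f :: "real ^ 'n \<Rightarrow> real"
  assumes "\<And>y. f differentiable (at y)" and L: "L-lipschitz_on UNIV (grad f)"
  shows "f (x + s) \<le> f x + grad f x \<bullet> s + L / 2 * (norm s)\<^sup>2"
proof -
  \<comment> \<open>The Taylor remainder along the segment minus its bound; it is shown to be nonincreasing.\<close>
  define \<phi> where "\<phi> t = f (x + t *\<^sub>R s) - t * (grad f x \<bullet> s) - L / 2 * t\<^sup>2 * (norm s)\<^sup>2" for t
  define \<phi>' where "\<phi>' t = (grad f (x + t *\<^sub>R s) - grad f x) \<bullet> s - L * t * (norm s)\<^sup>2" for t
  have "(\<phi> has_real_derivative \<phi>' t) (at t)" for t
  proof -
    have "((\<lambda>t. f (x + t *\<^sub>R s)) has_derivative (\<lambda>h. (h *\<^sub>R s) \<bullet> grad f (x + t *\<^sub>R s))) (at t)"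
      using GDERIV_grad[OF assms(1), of "x + t *\<^sub>R s"] unfolding gderiv_def
      by (rule has_derivative_compose[rotated]) (auto intro!: derivative_eq_intros)
    then have "((\<lambda>t. f (x + t *\<^sub>R s)) has_real_derivative (grad f (x + t *\<^sub>R s) \<bullet> s)) (at t)"
      by (simp add: has_field_derivative_def inner_commute mult_commute_abs)
    then show ?thesis
      unfolding \<phi>_def \<phi>'_def
      by (auto intro!: derivative_eq_intros simp: inner_diff_left)
  qed
  moreover have "\<phi>' t \<le> 0" if "0 \<le> t" for t
  proof -
    have "(grad f (x + t *\<^sub>R s) - grad f x) \<bullet> s \<le> norm (grad f (x + t *\<^sub>R s) - grad f x) * norm s"
      by (rule norm_cauchy_schwarz)
    also have "\<dots> \<le> L * norm (t *\<^sub>R s) * norm s"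
      using lipschitz_onD[OF L, of "x + t *\<^sub>R s" x] by (simp add: dist_norm mult_right_mono)
    finally show ?thesis
      using that by (simp add: \<phi>'_def power2_eq_square mult_ac)
  qed
  ultimately have "\<phi> 1 \<le> \<phi> 0"
    by (intro DERIV_nonpos_imp_nonincreasing[of 0 1 \<phi>]) (blast intro: zero_le_one)+
  then show ?thesis
    by (simp add: \<phi>_def)
qed

text \<open>The Taylor bound of \<open>f\<close> compares the true decrease with that of the model; the discrepancy consists
of the error of the gradient approximation along \<open>s\<close> and of second-order terms in \<open>s\<close>.\<close>

lemma step_decrease:
  fixes f :: "real ^ 'n \<Rightarrow> real" and x g :: "real ^ 'n" and l u :: "ereal ^ 'n"
  defines "d \<equiv> closest_point (box_set l u) (x - g) - x"
  assumes f: "\<And>y. f differentiable (at y)" and L: "L-lipschitz_on UNIV (grad f)"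
    and B: "onorm ((*v) B) \<le> \<kappa>" and "1 \<le> \<kappa>" and "0 < \<tau>"
    and x: "x \<in> box_set l u"
    and w: "\<And>i. \<mu> \<le> w $ i" "0 < \<mu>" "\<mu> \<le> 1" and \<Delta>: "\<And>i. \<Delta> $ i = \<bar>d $ i\<bar> / w $ i"
    and s: "quad_model g B s
      \<le> \<tau> * quad_model g B (quad_step g B (linear_step (box_set l u) x g \<Delta>))"
  shows "f (x + s) + \<tau> * \<mu> / (2 * \<kappa>) * (\<Sum>i\<in>UNIV. (d $ i)\<^sup>2 / w $ i)
    \<le> f x + \<bar>(grad f x - g) \<bullet> s\<bar> + (\<kappa> + L) / 2 * (norm s)\<^sup>2"
proof -
  define sL where "sL = linear_step (box_set l u) x g \<Delta>"
  note sL = linear_step_decrease[OF x w \<Delta>[unfolded d_def], folded sL_def d_def]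
  have "\<tau> * \<mu> / (2 * \<kappa>) * (\<Sum>i\<in>UNIV. (d $ i)\<^sup>2 / w $ i)
    = \<tau> / (2 * \<kappa>) * (\<mu> * (\<Sum>i\<in>UNIV. (d $ i)\<^sup>2 / w $ i))"
    by simp
  also have "\<dots> \<le> \<tau> / (2 * \<kappa>) * (- (g \<bullet> sL))"
    using sL(2) \<open>0 < \<tau>\<close> \<open>1 \<le> \<kappa>\<close> by (intro mult_left_mono) auto
  also have "\<dots> = \<tau> * (- (g \<bullet> sL) / (2 * \<kappa>))"
    by simp
  also have "\<dots> \<le> \<tau> * (- quad_model g B (quad_step g B sL))"
    using quad_model_quad_step[OF B \<open>1 \<le> \<kappa>\<close> sL(1)] \<open>0 < \<tau>\<close> by (intro mult_left_mono) auto
  also have "\<dots> \<le> - quad_model g B s"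
    using s by (simp add: sL_def)
  finally have model: "\<tau> * \<mu> / (2 * \<kappa>) * (\<Sum>i\<in>UNIV. (d $ i)\<^sup>2 / w $ i) \<le> - quad_model g B s" .
  have "grad f x \<bullet> s = (grad f x - g) \<bullet> s + quad_model g B s - 1/2 * (s \<bullet> (B *v s))"
    by (simp add: quad_model_def inner_diff_left)
  moreover have "- (s \<bullet> (B *v s)) \<le> \<kappa> * (norm s)\<^sup>2"
    using quadratic_form_bound[OF B, of s] by linarith
  moreover have "(\<kappa> + L) / 2 * (norm s)\<^sup>2 = 1/2 * (\<kappa> * (norm s)\<^sup>2) + L / 2 * (norm s)\<^sup>2"
    by (simp add: field_simps)
  ultimately show ?thesis
    using model descent_lemma[OF f L, of x s] abs_ge_self[of "(grad f x - g) \<bullet> s"] by linarith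
qed

section \<open>Sums driven by the AdaGrad weights\<close>

text \<open>One coordinate of the weights: \<open>w k\<close> is the square root of \<open>\<sigma>\<close> plus the sum of the squares
\<open>(d 0)\<^sup>2, \<dots>, (d k)\<^sup>2\<close>.\<close>

locale adagrad_weights =
  fixes \<sigma> :: real and d w :: "nat \<Rightarrow> real"
  assumes \<sigma>_pos: "0 < \<sigma>"
    and w_step: "w k = sqrt ((case k of 0 \<Rightarrow> sqrt \<sigma> | Suc j \<Rightarrow> w j)\<^sup>2 + (d k)\<^sup>2)"
begin

lemma w_square: "(w k)\<^sup>2 = \<sigma> + (\<Sum>j\<le>k. (d j)\<^sup>2)"
proof (induction k)
  case 0
  show ?case
    using \<sigma>_pos w_step[of 0] by simp
next
  case (Suc k)
  have "(w (Suc k))\<^sup>2 = (w k)\<^sup>2 + (d (Suc k))\<^sup>2"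
    by (subst w_step[of "Suc k"]) simp
  then show ?case
    using Suc by simp
qed

lemma w_ge: "sqrt \<sigma> \<le> w k" and w_pos: "0 < w k"
proof -
  have "w k = sqrt ((w k)\<^sup>2)"
    using w_step[of k] by simp
  also have "\<dots> = sqrt (\<sigma> + (\<Sum>j\<le>k. (d j)\<^sup>2))"
    by (simp only: w_square)
  finally show "sqrt \<sigma> \<le> w k"
    by (simp add: sum_nonneg)
  then show "0 < w k"
    using \<sigma>_pos less_le_trans[of 0 "sqrt \<sigma>" "w k"] by simp
qed

lemma w_Suc_square: "(w (Suc k))\<^sup>2 = (w k)\<^sup>2 + (d (Suc k))\<^sup>2"
  by (simp add: w_square)

lemma abs_le_w: "\<bar>d k\<bar> \<le> w k"
proof -
  have "(d k)\<^sup>2 \<le> (\<Sum>j\<le>k. (d j)\<^sup>2)"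
    by (rule member_le_sum) auto
  then have "(d k)\<^sup>2 \<le> (w k)\<^sup>2"
    using \<sigma>_pos unfolding w_square by linarith
  then have "\<bar>d k\<bar> \<le> \<bar>w k\<bar>"
    by (simp only: abs_le_square_iff)
  also have "\<bar>w k\<bar> = w k"
    using w_pos by (rule abs_of_pos)
  finally show ?thesis .
qed

text \<open>The increment of the weight is \<open>(d j)\<^sup>2\<close> divided by the sum of the old and the new weight, hence at
most \<open>(d j)\<^sup>2 / w j\<close>.\<close>

lemma w_le: "w k \<le> sqrt \<sigma> + (\<Sum>j\<le>k. (d j)\<^sup>2 / w j)"
proof -
  have *: "v - r \<le> e\<^sup>2 / v" if "v\<^sup>2 = r\<^sup>2 + e\<^sup>2" "0 < r" "0 < v" for v r e :: real
  proof -
    have "r\<^sup>2 \<le> v\<^sup>2"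
      using that(1) by simp
    then have "r \<le> v"
      using that(3) by (rule power2_le_imp_le[OF _ less_imp_le])
    then have "(v - r) * v \<le> (v - r) * (v + r)"
      using that(2) by (intro mult_left_mono) simp_all
    also have "\<dots> = e\<^sup>2"
      using that(1) by (simp add: power2_eq_square algebra_simps)
    finally show ?thesis
      using that(3) by (simp add: pos_le_divide_eq)
  qed
  show ?thesis
  proof (induction k)
    case 0
    show ?case
      using *[of "w 0" "sqrt \<sigma>" "d 0"] w_square[of 0] \<sigma>_pos w_pos[of 0] by simp
  next
    case (Suc k)
    then show ?case
      using *[OF w_Suc_square w_pos w_pos, of k] by simp
  qed
qed

text \<open>Each ratio is the relative increment of \<open>w\<^sup>2\<close>, which is bounded by the increment of
\<open>ln (w\<^sup>2)\<close>; the sum telescopes.\<close>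

lemma sum_ratio_le_ln: "(\<Sum>j\<le>k. (d j)\<^sup>2 / (w j)\<^sup>2) \<le> 2 * ln (w k / sqrt \<sigma>)"
proof -
  have *: "e\<^sup>2 / v\<^sup>2 \<le> 2 * ln v - 2 * ln r" if "v\<^sup>2 = r\<^sup>2 + e\<^sup>2" "0 < r" "0 < v" for v r e :: real
  proof -
    have "ln (r\<^sup>2) - ln (v\<^sup>2) \<le> (r\<^sup>2 - v\<^sup>2) / v\<^sup>2"
      using that(2,3) by (intro ln_diff_le) simp_all
    moreover have "r\<^sup>2 - v\<^sup>2 = - (e\<^sup>2)"
      using that(1) by linarith
    moreover have "ln (r\<^sup>2) = 2 * ln r" "ln (v\<^sup>2) = 2 * ln v"
      using that(2,3) by (simp_all add: ln_realpow)
    ultimately show ?thesis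
      by simp
  qed
  show ?thesis
  proof (induction k)
    case 0
    show ?case
      using *[of "w 0" "sqrt \<sigma>" "d 0"] w_square[of 0] \<sigma>_pos w_pos[of 0] by (simp add: ln_div)
  next
    case (Suc k)
    then show ?case
      using *[OF w_Suc_square w_pos w_pos, of k] \<sigma>_pos w_pos[of k] w_pos[of "Suc k"]
      by (simp add: ln_div)
  qed
qed

text \<open>The logarithm is replaced by its tangent of slope \<open>a\<close>. In this form the bound can be averaged, and
for small \<open>a\<close> the linear part is absorbed by the linear growth in \<open>w_le\<close>.\<close>

lemma sum_ratio_le_linear:
  assumes "0 < a"
  shows "(\<Sum>j\<le>k. (d j)\<^sup>2 / (w j)\<^sup>2) \<le> 2 * (a * w k + (ln (1 / (a * sqrt \<sigma>)) - 1))"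
proof -
  have "ln (a * w k) \<le> a * w k - 1"
    using assms w_pos[of k] by (intro ln_le_minus_one) simp
  then have "ln (w k / sqrt \<sigma>) \<le> a * w k + (ln (1 / (a * sqrt \<sigma>)) - 1)"
    using assms w_pos[of k] \<sigma>_pos by (simp add: ln_mult ln_div)
  then have "2 * ln (w k / sqrt \<sigma>) \<le> 2 * (a * w k + (ln (1 / (a * sqrt \<sigma>)) - 1))"
    by (rule mult_left_mono) simp
  with sum_ratio_le_ln show ?thesis
    by (rule order_trans)
qed

end

text \<open>Cauchy-Schwarz over the iterations, together with the fact that the weights dominate the root of
the accumulated squares.\<close>

lemma sum_norm_le_weights:
  fixes d w :: "nat \<Rightarrow> real ^ 'n"
  assumes weights: "\<And>i. adagrad_weights \<sigma> (\<lambda>k. d k $ i) (\<lambda>k. w k $ i)"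
  shows "(\<Sum>j\<le>k. norm (d j)) \<le> sqrt (real k + 1) * (\<Sum>i\<in>UNIV. w k $ i)"
proof -
  have "(\<Sum>j\<le>k. (norm (d j))\<^sup>2) = (\<Sum>i\<in>UNIV. \<Sum>j\<le>k. (d j $ i)\<^sup>2)"
    by (subst sum.swap) (simp add: norm_square_vec)
  also have "\<dots> \<le> (\<Sum>i\<in>UNIV. (w k $ i)\<^sup>2)"
  proof (rule sum_mono)
    fix i
    interpret adagrad_weights \<sigma> "\<lambda>k. d k $ i" "\<lambda>k. w k $ i"
      by (rule weights)
    show "(\<Sum>j\<le>k. (d j $ i)\<^sup>2) \<le> (w k $ i)\<^sup>2"
      using w_square[of k] \<sigma>_pos by simp
  qed
  also have "\<dots> = (norm (w k))\<^sup>2"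
    by (simp add: norm_square_vec)
  finally have "(\<Sum>j\<le>k. (norm (d j))\<^sup>2) * (real k + 1) \<le> (norm (w k))\<^sup>2 * (real k + 1)"
    by (intro mult_right_mono) auto
  moreover have "(\<Sum>j\<le>k. norm (d j))\<^sup>2 \<le> (\<Sum>j\<le>k. (norm (d j))\<^sup>2) * (real k + 1)"
    using sum_squared_le_sum_of_squares[of "\<lambda>j. norm (d j)" "{..k}"] by (simp add: add.commute)
  ultimately have "(\<Sum>j\<le>k. norm (d j))\<^sup>2 \<le> (norm (w k))\<^sup>2 * (real k + 1)"
    by linarith
  then have "(\<Sum>j\<le>k. norm (d j)) \<le> sqrt ((norm (w k))\<^sup>2 * (real k + 1))"
    by (rule real_le_rsqrt)
  also have "\<dots> = sqrt (real k + 1) * norm (w k)"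
    by (simp add: real_sqrt_mult)
  also have "\<dots> \<le> sqrt (real k + 1) * (\<Sum>i\<in>UNIV. w k $ i)"
  proof (rule mult_left_mono)
    have "\<bar>w k $ i\<bar> = w k $ i" for i
      using adagrad_weights.w_pos[OF weights, of k i] by simp
    then show "norm (w k) \<le> (\<Sum>i\<in>UNIV. w k $ i)"
      using norm_le_l1_cart[of "w k"] by simp
  qed simp
  finally show ?thesis .
qed

section \<open>Conditional expectations\<close>

lemma (in sigma_finite_subalgebra) nn_integral_nn_cond_exp:
  assumes "X \<in> borel_measurable M"
  shows "(\<integral>\<^sup>+ \<omega>. nn_cond_exp M F X \<omega> \<partial>M) = (\<integral>\<^sup>+ \<omega>. X \<omega> \<partial>M)"
  using nn_cond_exp_intg[of "\<lambda>_. 1" X] assms by simp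

lemma ennreal_inverse_mult_self: "0 < r \<Longrightarrow> r < \<top> \<Longrightarrow> inverse r * r = 1" for r :: ennreal
  using ennreal_divide_self[of r] by (simp add: divide_ennreal_def mult.commute)

lemma ennreal_young:
  fixes x r :: ennreal
  assumes "0 < r"
  shows "2 * x \<le> inverse r * x\<^sup>2 + r"
proof (cases "x = \<top> \<or> r = \<top>")
  case True
  then show ?thesis
    using assms by (cases "r = \<top>") (auto simp: ennreal_mult_top ennreal_top_mult power2_eq_square)
next
  case False
  have r: "inverse r * r = 1"
    using assms False by (simp add: ennreal_inverse_mult_self less_top)
  have "2 * x = (inverse r * r) * (2 * x)"
    by (simp add: r)
  also have "\<dots> = inverse r * (2 * x * r)"
    by (simp only: ac_simps)
  also have "\<dots> \<le> inverse r * (x\<^sup>2 + r\<^sup>2)"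
    by (intro mult_left_mono sum_of_squares_ge_ennreal) simp
  also have "\<dots> = inverse r * x\<^sup>2 + (inverse r * r) * r"
    by (simp add: power2_eq_square distrib_left ac_simps)
  finally show ?thesis
    by (simp add: r)
qed

text \<open>A conditional Jensen inequality that needs no integrability: the mean of \<open>X\<close> is at most the mean of
any \<open>F\<close>-measurable bound \<open>R\<close> of its conditional root mean square. Young's inequality
\<open>2 * X \<le> X\<^sup>2 / r + r\<close> with the \<open>F\<close>-measurable function \<open>r = R + 2 * e\<close> allows to replace \<open>X\<^sup>2\<close> by
its conditional expectation under the integral; the shift by \<open>2 * e\<close> makes \<open>r\<close> invertible.\<close>

lemma (in sigma_finite_subalgebra) nn_integral_le_conditional_rms:
  assumes "prob_space M"
    and X: "X \<in> borel_measurable M" and R: "R \<in> borel_measurable F"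
    and le: "AE \<omega> in M. nn_cond_exp M F (\<lambda>\<omega>. (X \<omega>)\<^sup>2) \<omega> \<le> (R \<omega>)\<^sup>2"
  shows "(\<integral>\<^sup>+ \<omega>. X \<omega> \<partial>M) \<le> (\<integral>\<^sup>+ \<omega>. R \<omega> \<partial>M)"
proof (rule ennreal_le_epsilon)
  interpret prob_space M
    by fact
  note [measurable] = X R measurable_from_subalg[OF subalg R]
  fix e :: real
  assume "0 < e"
  define r where "r \<omega> = R \<omega> + ennreal (2 * e)" for \<omega>
  have [measurable]: "r \<in> borel_measurable F" "r \<in> borel_measurable M"
    by (simp_all add: r_def[abs_def])
  have "0 < r \<omega>" for \<omega>
    using \<open>0 < e\<close> by (simp add: r_def add_nonneg_pos)
  \<comment> \<open>For infinite \<open>R\<close> the inverse vanishes, and \<open>0 * \<infinity> = 0\<close>.\<close>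
  have quotient: "inverse (R + ennreal (2 * e)) * R\<^sup>2 \<le> R" for R :: ennreal
  proof (cases "R = \<top>")
    case False
    have "inverse (R + ennreal (2 * e)) * R\<^sup>2 = inverse (R + ennreal (2 * e)) * R * R"
      by (simp add: power2_eq_square mult.assoc)
    also have "\<dots> \<le> inverse (R + ennreal (2 * e)) * (R + ennreal (2 * e)) * R"
      by (intro mult_left_mono mult_right_mono) simp_all
    also have "\<dots> = R"
    proof -
      have "R + ennreal (2 * e) \<noteq> 0" "R + ennreal (2 * e) \<noteq> \<top>"
        using False \<open>0 < e\<close> by simp_all
      then show ?thesis
        by (simp add: ennreal_inverse_mult_self less_top zero_less_iff_neq_zero)
    qed
    finally show ?thesis .
  qed simp
  have "(\<integral>\<^sup>+ \<omega>. inverse (r \<omega>) * (X \<omega>)\<^sup>2 \<partial>M)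
    = (\<integral>\<^sup>+ \<omega>. inverse (r \<omega>) * nn_cond_exp M F (\<lambda>\<omega>. (X \<omega>)\<^sup>2) \<omega> \<partial>M)"
    by (intro nn_cond_exp_intg[symmetric]) simp_all
  also have "\<dots> \<le> (\<integral>\<^sup>+ \<omega>. R \<omega> \<partial>M)"
  proof (rule nn_integral_mono_AE)
    show "AE \<omega> in M. inverse (r \<omega>) * nn_cond_exp M F (\<lambda>\<omega>. (X \<omega>)\<^sup>2) \<omega> \<le> R \<omega>"
      using le
    proof eventually_elim
      case (elim \<omega>)
      have "inverse (r \<omega>) * nn_cond_exp M F (\<lambda>\<omega>. (X \<omega>)\<^sup>2) \<omega> \<le> inverse (r \<omega>) * (R \<omega>)\<^sup>2"
        using elim by (rule mult_left_mono) simp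
      also have "\<dots> \<le> R \<omega>"
        unfolding r_def by (rule quotient)
      finally show ?case .
    qed
  qed
  finally have quotients: "(\<integral>\<^sup>+ \<omega>. inverse (r \<omega>) * (X \<omega>)\<^sup>2 \<partial>M) \<le> (\<integral>\<^sup>+ \<omega>. R \<omega> \<partial>M)" .
  have r: "(\<integral>\<^sup>+ \<omega>. r \<omega> \<partial>M) = (\<integral>\<^sup>+ \<omega>. R \<omega> \<partial>M) + ennreal (2 * e)"
    unfolding r_def by (subst nn_integral_add) (simp_all add: emeasure_space_1)
  have "2 * (\<integral>\<^sup>+ \<omega>. X \<omega> \<partial>M) = (\<integral>\<^sup>+ \<omega>. 2 * X \<omega> \<partial>M)"
    by (simp add: nn_integral_cmult)
  also have "\<dots> \<le> (\<integral>\<^sup>+ \<omega>. inverse (r \<omega>) * (X \<omega>)\<^sup>2 + r \<omega> \<partial>M)"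
    using \<open>\<And>\<omega>. 0 < r \<omega>\<close> by (intro nn_integral_mono ennreal_young)
  also have "\<dots> = (\<integral>\<^sup>+ \<omega>. inverse (r \<omega>) * (X \<omega>)\<^sup>2 \<partial>M) + (\<integral>\<^sup>+ \<omega>. r \<omega> \<partial>M)"
    by (intro nn_integral_add) simp_all
  also have "\<dots> \<le> (\<integral>\<^sup>+ \<omega>. R \<omega> \<partial>M) + ((\<integral>\<^sup>+ \<omega>. R \<omega> \<partial>M) + ennreal (2 * e))"
    using quotients by (simp only: r add_right_mono)
  also have "\<dots> = 2 * ((\<integral>\<^sup>+ \<omega>. R \<omega> \<partial>M) + ennreal e)"
  proof -
    have "ennreal (2 * e) = ennreal e + ennreal e"
      using \<open>0 < e\<close> by (subst ennreal_plus[symmetric]) simp_all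
    then show ?thesis
      by (simp only: mult_2 add_ac)
  qed
  finally have "2 * (\<integral>\<^sup>+ \<omega>. X \<omega> \<partial>M) \<le> 2 * ((\<integral>\<^sup>+ \<omega>. R \<omega> \<partial>M) + ennreal e)" .
  then show "(\<integral>\<^sup>+ \<omega>. X \<omega> \<partial>M) \<le> (\<integral>\<^sup>+ \<omega>. R \<omega> \<partial>M) + ennreal e"
    by (subst (asm) ennreal_mult_le_mult_iff) simp_all
qed

lemma ennreal_sqrt_le_iff: "ennreal_sqrt a \<le> b \<longleftrightarrow> a \<le> b\<^sup>2"
proof (cases a; cases b)
  fix p q :: real
  assume "a = ennreal p" "0 \<le> p" "b = ennreal q" "0 \<le> q"
  then show ?thesis
    by (simp add: ennreal_sqrt_def ennreal_power real_sqrt_le_iff')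
qed (auto simp: ennreal_sqrt_def power2_eq_square ennreal_mult_eq_top_iff top_unique)

lemma subalgebra_past_of_measurable:
  fixes g :: "nat \<Rightarrow> 'w \<Rightarrow> real ^ 'n"
  assumes "\<And>k. g k \<in> borel_measurable M"
  shows "subalgebra M (past M g k)"
proof -
  have "{g j -` A \<inter> space M | j A. j < k \<and> A \<in> sets borel} \<subseteq> sets M"
    using assms by (auto intro: measurable_sets)
  then show ?thesis
    unfolding subalgebra_def past_def
    by (simp add: sets.sigma_sets_subset sets.space_closed space_measure_of_conv
        sets_measure_of subset_trans[OF _ sets.space_closed])
qed

section \<open>The constant of the convergence rate\<close>

text \<open>The hypothesis is the bound that the averaged argument yields; the remaining work is to recognise
\<open>kappa_conv\<close> in it. The factor \<open>n\<close> in the logarithm of \<open>kappa_conv\<close> contributes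
\<open>2 * n * \<kappa> * ln n \<ge> n - 1\<close>, which pays for the term that comes from the initial weights. The
bracket in \<open>kappa_conv\<close> is nonnegative because the argument of its logarithm is at least \<open>4\<close>, so
that its coefficient may be enlarged.\<close>

lemma weight_le_kappa_conv:
  fixes n \<sigma> \<tau> \<kappa>B \<kappa> \<Gamma> W :: real
  assumes "1 \<le> n" "0 < \<sigma>" "\<sigma> \<le> 1" "0 < \<tau>" "\<tau> \<le> 1" "1 \<le> \<kappa>B" "1/2 \<le> \<kappa>" "0 \<le> \<Gamma>"
    and W: "\<tau> * sqrt \<sigma> / (4 * \<kappa>B) * W
      \<le> n * \<tau> * \<sigma> / (2 * \<kappa>B) + \<Gamma> + 2 * n * \<kappa> * (ln (8 * \<kappa> * \<kappa>B / (\<tau> * \<sigma>)) - 1)"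
  shows "W \<le> kappa_conv n \<sigma> \<tau> \<kappa>B \<kappa> \<Gamma>"
proof -
  define \<Lambda> where "\<Lambda> = ln (8 * n * \<kappa> * \<kappa>B / (\<tau> * \<sigma> powr (5/2)))"
  define K where "K = 1 + \<Gamma> + 2 * n * \<kappa> * (\<Lambda> - 1)"
  have pos: "0 < n" "0 < \<kappa>B" "0 < \<kappa>"
    using assms by simp_all
  have \<sigma>_powr: "0 < \<sigma> powr (5/2)" "\<sigma> powr (5/2) \<le> \<sigma>"
    using powr_mono'[of 1 "5/2" \<sigma>] assms by simp_all
  have denominators: "0 < \<tau> * \<sigma>" "0 < \<tau> * \<sigma> powr (5/2)"
    using \<open>0 < \<tau>\<close> \<open>0 < \<sigma>\<close> \<sigma>_powr(1) by (blast intro: mult_pos_pos)+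
  have "n * \<tau> * \<sigma> / (2 * \<kappa>B) \<le> n * 1 * 1 / (2 * 1)"
    using assms by (intro frac_le mult_mono) simp_all
  also have "\<dots> \<le> 1 + (n - 1)"
    using assms by simp
  also have "n - 1 \<le> 2 * n * \<kappa> * ln n"
  proof -
    have "n - 1 = n * (1 - 1 / n)"
      using pos by (simp add: field_simps)
    also have "\<dots> \<le> n * ln n"
    proof (rule mult_left_mono)
      show "1 - 1 / n \<le> ln n"
        using ln_le_minus_one[of "1 / n"] pos by (simp add: ln_div)
    qed (use pos in simp)
    also have "\<dots> \<le> n * ln n * (2 * \<kappa>)"
      using assms mult_left_mono[of 1 "2 * \<kappa>" "n * ln n"] by simp
    finally show ?thesis
      by (simp add: mult_ac)
  qed
  finally have first: "n * \<tau> * \<sigma> / (2 * \<kappa>B) \<le> 1 + 2 * n * \<kappa> * ln n"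
    by simp
  have "ln (8 * \<kappa> * \<kappa>B / (\<tau> * \<sigma>)) + ln n = ln (8 * \<kappa> * \<kappa>B / (\<tau> * \<sigma>) * n)"
    using pos assms by (subst ln_mult) simp_all
  also have "8 * \<kappa> * \<kappa>B / (\<tau> * \<sigma>) * n = 8 * n * \<kappa> * \<kappa>B / (\<tau> * \<sigma>)"
    by simp
  also have "ln \<dots> \<le> \<Lambda>"
    unfolding \<Lambda>_def using pos assms denominators
    by (intro ln_mono divide_left_mono mult_left_mono \<sigma>_powr mult_pos_pos divide_pos_pos) simp_all
  finally have \<Lambda>: "ln (8 * \<kappa> * \<kappa>B / (\<tau> * \<sigma>)) + ln n \<le> \<Lambda>" .
  have "\<tau> * sqrt \<sigma> / (4 * \<kappa>B) * W
    \<le> 1 + \<Gamma> + 2 * n * \<kappa> * ((ln (8 * \<kappa> * \<kappa>B / (\<tau> * \<sigma>)) + ln n) - 1)"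
    using W first by (simp add: algebra_simps)
  also have "\<dots> \<le> K"
    unfolding K_def using \<Lambda> pos by (intro add_left_mono mult_left_mono) simp_all
  finally have W_le: "\<tau> * sqrt \<sigma> / (4 * \<kappa>B) * W \<le> K" .
  have "1 \<le> \<Lambda>"
  proof -
    have "\<tau> * \<sigma> powr (5/2) \<le> 1 * 1"
      using assms \<sigma>_powr by (intro mult_mono) simp_all
    moreover have "1 * (1/2) * 1 \<le> n * \<kappa> * \<kappa>B"
      using assms by (intro mult_mono) simp_all
    then have "4 \<le> 8 * n * \<kappa> * \<kappa>B"
      by linarith
    ultimately have "4 / 1 \<le> 8 * n * \<kappa> * \<kappa>B / (\<tau> * \<sigma> powr (5/2))"
      using denominators by (intro frac_le) linarith+
    then have "exp 1 \<le> 8 * n * \<kappa> * \<kappa>B / (\<tau> * \<sigma> powr (5/2))"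
      using exp_le by linarith
    then show ?thesis
      unfolding \<Lambda>_def using pos denominators by (subst ln_ge_iff) simp_all
  qed
  then have "0 \<le> K"
    unfolding K_def using assms pos by simp
  have "W = 4 * \<kappa>B / (\<tau> * sqrt \<sigma>) * (\<tau> * sqrt \<sigma> / (4 * \<kappa>B) * W)"
    using assms by simp
  also have "\<dots> \<le> 4 * \<kappa>B / (\<tau> * sqrt \<sigma>) * K"
    using W_le assms by (intro mult_left_mono) simp_all
  also have "\<dots> \<le> 4 * \<kappa>B / (\<tau> * \<sigma>\<^sup>2) * K"
  proof -
    have "\<sigma>\<^sup>2 \<le> \<sigma>" "\<sigma>\<^sup>2 \<le> 1"
      using assms by (simp_all add: power_le_one power2_eq_square[of \<sigma>] mult_left_le mult_le_one)
    then have "(\<sigma>\<^sup>2)\<^sup>2 \<le> \<sigma>"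
      using mult_left_le[of "\<sigma>\<^sup>2" "\<sigma>\<^sup>2"] by (simp add: power2_eq_square)
    then have "\<sigma>\<^sup>2 \<le> sqrt \<sigma>"
      by (rule real_le_rsqrt)
    then show ?thesis
      using assms \<open>0 \<le> K\<close> by (intro mult_right_mono divide_left_mono mult_left_mono) simp_all
  qed
  finally show ?thesis
    by (simp add: kappa_conv_def K_def \<Lambda>_def)
qed

section \<open>The algorithm as a random process\<close>

text \<open>In the decrease of \<open>f\<close> the gradient error acts along the step only, through \<open>dir_error\<close>; the bound on its root mean
square concerns the passage from the computed to the exact criticality measure and is a hypothesis of
the lemmas on that passage.\<close>

locale adagb2_process = prob_space M
  for M :: "'w measure" +
  fixes f :: "real ^ 'n \<Rightarrow> real"
    and l u :: "ereal ^ 'n"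
    and x_ini :: "real ^ 'n"
    and x g d w \<Delta> s :: "nat \<Rightarrow> 'w \<Rightarrow> real ^ 'n"
    and B :: "nat \<Rightarrow> 'w \<Rightarrow> real ^ 'n ^ 'n"
    and \<sigma> \<tau> \<kappa>s L \<kappa>B f_low \<kappa>Gg :: real
  assumes constants: "0 < \<sigma>" "\<sigma> \<le> 1" "0 < \<tau>" "\<tau> \<le> 1" "1 \<le> \<kappa>s" "1 \<le> \<kappa>B"
    and run: "\<And>\<omega>. \<omega> \<in> space M \<Longrightarrow>
      adagb2_run l u \<sigma> \<tau> \<kappa>s x_ini (\<lambda>k. x k \<omega>) (\<lambda>k. g k \<omega>) (\<lambda>k. d k \<omega>) (\<lambda>k. w k \<omega>)
        (\<lambda>k. \<Delta> k \<omega>) (\<lambda>k. B k \<omega>) (\<lambda>k. s k \<omega>)"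
    and g_measurable [measurable]: "\<And>k. g k \<in> borel_measurable M"
    and s_measurable [measurable]: "\<And>k. s k \<in> borel_measurable M"
    and adapted: "\<And>k. x k \<in> borel_measurable (past M g k)"
    and nonempty: "box_set l u \<noteq> {}"
    and differentiable: "\<And>y. f differentiable (at y)"
    and lipschitz: "L-lipschitz_on UNIV (grad f)"
    and B_bound: "AE \<omega> in M. \<forall>k. onorm ((*v) (B k \<omega>)) \<le> \<kappa>B"
    and f_low: "\<And>y. y \<in> box_set l u \<Longrightarrow> f_low \<le> f y"
    and dir_error: "\<And>k. AE \<omega> in M.
      cond_E M g k (\<lambda>\<omega>'. \<bar>(grad f (x k \<omega>') - g k \<omega>') \<bullet> s k \<omega>'\<bar>) \<omega>
        \<le> ennreal (\<kappa>Gg\<^sup>2) * cond_E M g k (\<lambda>\<omega>'. (norm (s k \<omega>'))\<^sup>2) \<omega>"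
begin

definition gain :: "nat \<Rightarrow> 'w \<Rightarrow> real" where
  "gain k \<omega> = (\<Sum>i\<in>UNIV. (d k \<omega> $ i)\<^sup>2 / w k \<omega> $ i)"

text \<open>The squared Euclidean norm of the vector \<open>\<Delta>\<close> of trust-region radii.\<close>

definition radius_sq :: "nat \<Rightarrow> 'w \<Rightarrow> real" where
  "radius_sq k \<omega> = (\<Sum>i\<in>UNIV. (d k \<omega> $ i)\<^sup>2 / (w k \<omega> $ i)\<^sup>2)"

definition weight_sum :: "nat \<Rightarrow> 'w \<Rightarrow> real" where
  "weight_sum k \<omega> = (\<Sum>i\<in>UNIV. w k \<omega> $ i)"

abbreviation gap :: "nat \<Rightarrow> 'w \<Rightarrow> real" where
  "gap k \<omega> \<equiv> f (x k \<omega>) - f_low"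

abbreviation \<Gamma>0 :: real where
  "\<Gamma>0 \<equiv> f (closest_point (box_set l u) x_ini) - f_low"

text \<open>The coefficient of \<open>gain\<close> in the guaranteed decrease of \<open>f\<close>: the fraction \<open>\<tau>\<close> of the model decrease
is required, curvature may reduce the linear decrease to its \<open>1 / (2 * \<kappa>B)\<close>-fold, and \<open>sqrt \<sigma>\<close> is the
lower bound of the weights that governs the truncation by the trust region.\<close>

definition rate :: real where
  "rate = \<tau> * sqrt \<sigma> / (2 * \<kappa>B)"

abbreviation \<kappa>star :: real where
  "\<kappa>star \<equiv> kappa_star \<kappa>s \<kappa>Gg \<kappa>B L"

lemma rate_pos: "0 < rate"
  using constants by (simp add: rate_def)

lemma L_nonneg: "0 \<le> L"
  using lipschitz by (rule lipschitz_on_nonneg)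

lemma \<kappa>star_ge: "1/2 \<le> \<kappa>star"
proof -
  have "1/2 \<le> \<kappa>Gg\<^sup>2 + 1/2 * (\<kappa>B + L)"
    using constants L_nonneg by (simp add: add_increasing)
  moreover have "1 \<le> \<kappa>s\<^sup>2"
    using constants by (simp add: one_le_power)
  ultimately show ?thesis
    unfolding kappa_star_def using mult_mono[of 1 "\<kappa>s\<^sup>2" "1/2" "\<kappa>Gg\<^sup>2 + 1/2 * (\<kappa>B + L)"] by simp
qed

context
  fixes \<omega>
  assumes \<omega>: "\<omega> \<in> space M"
begin

lemma run_simps:
  shows "x 0 \<omega> = closest_point (box_set l u) x_ini"
    and "d k \<omega> = closest_point (box_set l u) (x k \<omega> - g k \<omega>) - x k \<omega>"
    and "\<Delta> k \<omega> $ i = \<bar>d k \<omega> $ i\<bar> / w k \<omega> $ i"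
    and "\<bar>s k \<omega> $ i\<bar> \<le> \<kappa>s * \<Delta> k \<omega> $ i"
    and "x k \<omega> + s k \<omega> \<in> box_set l u"
    and "quad_model (g k \<omega>) (B k \<omega>) (s k \<omega>) \<le> \<tau> * quad_model (g k \<omega>) (B k \<omega>)
      (quad_step (g k \<omega>) (B k \<omega>) (linear_step (box_set l u) (x k \<omega>) (g k \<omega>) (\<Delta> k \<omega>)))"
    and "x (Suc k) \<omega> = x k \<omega> + s k \<omega>"
  using run[OF \<omega>] unfolding adagb2_run_def by blast+

lemma iterate_in_box: "x k \<omega> \<in> box_set l u"
proof (cases k)
  case 0
  then show ?thesis
    using closest_point_in_set[OF closed_convex_box_set(1) nonempty] by (simp add: run_simps)
next
  case (Suc j)
  then show ?thesis
    by (simp add: run_simps)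
qed

lemma weights: "adagrad_weights \<sigma> (\<lambda>k. d k \<omega> $ i) (\<lambda>k. w k \<omega> $ i)"
  using run[OF \<omega>] constants unfolding adagb2_run_def by unfold_locales auto

lemma norm_step_sq_le: "(norm (s k \<omega>))\<^sup>2 \<le> \<kappa>s\<^sup>2 * radius_sq k \<omega>"
proof -
  have "(s k \<omega> $ i)\<^sup>2 \<le> \<kappa>s\<^sup>2 * ((d k \<omega> $ i)\<^sup>2 / (w k \<omega> $ i)\<^sup>2)" for i
  proof -
    have "\<bar>s k \<omega> $ i\<bar>\<^sup>2 \<le> (\<kappa>s * \<Delta> k \<omega> $ i)\<^sup>2"
      by (intro power_mono run_simps) simp
    then show ?thesis
      by (simp add: run_simps(3) power_mult_distrib power_divide)
  qed
  then show ?thesis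
    unfolding norm_square_vec radius_sq_def sum_distrib_left by (rule sum_mono)
qed

text \<open>Each radius is at most one, however large the sampled gradient is. The finiteness of all expectations
goes back to this bound.\<close>

lemma radius_sq_le: "radius_sq k \<omega> \<le> real CARD('n)"
proof -
  have "(d k \<omega> $ i)\<^sup>2 / (w k \<omega> $ i)\<^sup>2 \<le> 1" for i
  proof -
    interpret adagrad_weights \<sigma> "\<lambda>k. d k \<omega> $ i" "\<lambda>k. w k \<omega> $ i"
      by (rule weights)
    have "(d k \<omega> $ i)\<^sup>2 \<le> (w k \<omega> $ i)\<^sup>2"
      using abs_le_w[of k] w_pos[of k] by (simp add: abs_le_square_iff[symmetric])
    then show ?thesis
      using w_pos[of k] by (simp add: divide_le_eq_1)
  qed
  then show ?thesis
    unfolding radius_sq_def using sum_bounded_above[of UNIV _ "1 :: real"] by fastforce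
qed

lemma gain_nonneg: "0 \<le> gain k \<omega>" and radius_sq_nonneg: "0 \<le> radius_sq k \<omega>"
  and weight_sum_nonneg: "0 \<le> weight_sum k \<omega>"
  using adagrad_weights.w_pos[OF weights]
  by (simp_all add: gain_def radius_sq_def weight_sum_def sum_nonneg less_imp_le)

lemma gap_nonneg: "0 \<le> gap k \<omega>"
  using f_low[OF iterate_in_box] by simp

lemma weight_sum_le: "weight_sum k \<omega> \<le> real CARD('n) * sqrt \<sigma> + (\<Sum>j\<le>k. gain j \<omega>)"
proof -
  have "weight_sum k \<omega> \<le> (\<Sum>i\<in>UNIV. sqrt \<sigma> + (\<Sum>j\<le>k. (d j \<omega> $ i)\<^sup>2 / w j \<omega> $ i))"
    unfolding weight_sum_def by (intro sum_mono adagrad_weights.w_le weights)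
  also have "\<dots> = real CARD('n) * sqrt \<sigma> + (\<Sum>j\<le>k. gain j \<omega>)"
    unfolding gain_def sum.distrib by (subst sum.swap) simp
  finally show ?thesis .
qed

lemma sum_radius_sq_le:
  assumes "0 < a"
  shows "(\<Sum>j\<le>k. radius_sq j \<omega>)
    \<le> 2 * (a * weight_sum k \<omega> + real CARD('n) * (ln (1 / (a * sqrt \<sigma>)) - 1))"
proof -
  have "(\<Sum>j\<le>k. radius_sq j \<omega>) = (\<Sum>i\<in>UNIV. \<Sum>j\<le>k. (d j \<omega> $ i)\<^sup>2 / (w j \<omega> $ i)\<^sup>2)"
    unfolding radius_sq_def by (rule sum.swap)
  also have "\<dots> \<le> (\<Sum>i\<in>UNIV. 2 * (a * w k \<omega> $ i + (ln (1 / (a * sqrt \<sigma>)) - 1)))"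
    by (intro sum_mono adagrad_weights.sum_ratio_le_linear weights assms)
  also have "\<dots> = 2 * (a * weight_sum k \<omega> + real CARD('n) * (ln (1 / (a * sqrt \<sigma>)) - 1))"
    unfolding weight_sum_def by (simp add: sum.distrib sum_distrib_left[symmetric])
  finally show ?thesis .
qed

lemma gap_decrease:
  assumes "onorm ((*v) (B k \<omega>)) \<le> \<kappa>B"
  shows "gap (Suc k) \<omega> + rate * gain k \<omega>
    \<le> gap k \<omega> + \<bar>(grad f (x k \<omega>) - g k \<omega>) \<bullet> s k \<omega>\<bar> + (\<kappa>B + L) / 2 * (norm (s k \<omega>))\<^sup>2"
proof -
  have "f (x k \<omega> + s k \<omega>) + rate * gain k \<omega>
    \<le> f (x k \<omega>) + \<bar>(grad f (x k \<omega>) - g k \<omega>) \<bullet> s k \<omega>\<bar> + (\<kappa>B + L) / 2 * (norm (s k \<omega>))\<^sup>2"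
    unfolding gain_def rate_def run_simps(2)
  proof (rule step_decrease)
    show "sqrt \<sigma> \<le> w k \<omega> $ i" for i
      using adagrad_weights.w_ge[OF weights] .
    show "\<Delta> k \<omega> $ i = \<bar>(closest_point (box_set l u) (x k \<omega> - g k \<omega>) - x k \<omega>) $ i\<bar> / w k \<omega> $ i"
      for i
      by (simp only: run_simps)
  qed (use differentiable lipschitz assms constants iterate_in_box run_simps in auto)
  then show ?thesis
    by (simp add: run_simps(7))
qed

end

section \<open>Measurability\<close>

lemma subalgebra_past: "subalgebra M (past M g k)"
  using g_measurable by (rule subalgebra_past_of_measurable)

lemma past_sigma_finite: "sigma_finite_subalgebra M (past M g k)"
  by (intro finite_measure_subalgebra_is_sigma_finite finite_measure_subalgebra.intro
      finite_measure_subalgebra_axioms.intro subalgebra_past finite_measure_axioms)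

lemma x_measurable [measurable]: "x k \<in> borel_measurable M"
  using subalgebra_past adapted by (rule measurable_from_subalg)

lemma continuous_f: "continuous_on UNIV f"
  using differentiable by (intro continuous_at_imp_continuous_on ballI differentiable_imp_continuous_within)

lemma f_measurable [measurable]: "f \<in> borel_measurable borel"
  using continuous_f by (rule borel_measurable_continuous_onI)

lemma grad_measurable [measurable]: "grad f \<in> borel_measurable borel"
  using lipschitz_on_continuous_on[OF lipschitz] by (rule borel_measurable_continuous_onI)

lemma projection_measurable [measurable]: "closest_point (box_set l u) \<in> borel_measurable borel"
  using continuous_on_closest_point[OF closed_convex_box_set(2,1) nonempty]
  by (rule borel_measurable_continuous_onI)

lemma d_measurable [measurable]: "d k \<in> borel_measurable M"
proof -
  have "(\<lambda>\<omega>. closest_point (box_set l u) (x k \<omega> - g k \<omega>) - x k \<omega>) \<in> borel_measurable M"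
    by measurable
  then show ?thesis
    by (simp add: run_simps(2) cong: measurable_cong)
qed

lemma d_nth_measurable [measurable]: "(\<lambda>\<omega>. d k \<omega> $ i) \<in> borel_measurable M"
  using d_measurable borel_measurable_nth by (rule measurable_compose)

lemma w_measurable [measurable]: "(\<lambda>\<omega>. w k \<omega> $ i) \<in> borel_measurable M"
proof -
  have "w k \<omega> $ i = sqrt (\<sigma> + (\<Sum>j\<le>k. (d j \<omega> $ i)\<^sup>2))" if "\<omega> \<in> space M" for \<omega>
    using adagrad_weights.w_square[OF weights[OF that], of k i]
      adagrad_weights.w_pos[OF weights[OF that], of k i]
    by (metis abs_of_pos real_sqrt_abs)
  moreover have "(\<lambda>\<omega>. sqrt (\<sigma> + (\<Sum>j\<le>k. (d j \<omega> $ i)\<^sup>2))) \<in> borel_measurable M"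
    by measurable
  ultimately show ?thesis
    by (simp cong: measurable_cong)
qed

lemma gain_measurable [measurable]: "gain k \<in> borel_measurable M"
  and radius_sq_measurable [measurable]: "radius_sq k \<in> borel_measurable M"
  and weight_sum_measurable [measurable]: "weight_sum k \<in> borel_measurable M"
  unfolding gain_def[abs_def] radius_sq_def[abs_def] weight_sum_def[abs_def] by measurable

section \<open>Decrease of the objective in expectation\<close>

lemma nn_integral_cond_E:
  assumes "X \<in> borel_measurable M"
  shows "(\<integral>\<^sup>+ \<omega>. cond_E M g k X \<omega> \<partial>M) = (\<integral>\<^sup>+ \<omega>. ennreal (X \<omega>) \<partial>M)"
  unfolding cond_E_def using assms
  by (intro sigma_finite_subalgebra.nn_integral_nn_cond_exp past_sigma_finite) simp

lemma expected_directional_error: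
  "(\<integral>\<^sup>+ \<omega>. ennreal \<bar>(grad f (x k \<omega>) - g k \<omega>) \<bullet> s k \<omega>\<bar> \<partial>M)
    \<le> ennreal (\<kappa>Gg\<^sup>2) * (\<integral>\<^sup>+ \<omega>. ennreal ((norm (s k \<omega>))\<^sup>2) \<partial>M)"
proof -
  have "(\<integral>\<^sup>+ \<omega>. ennreal \<bar>(grad f (x k \<omega>) - g k \<omega>) \<bullet> s k \<omega>\<bar> \<partial>M)
    = (\<integral>\<^sup>+ \<omega>. cond_E M g k (\<lambda>\<omega>'. \<bar>(grad f (x k \<omega>') - g k \<omega>') \<bullet> s k \<omega>'\<bar>) \<omega> \<partial>M)"
    by (rule nn_integral_cond_E[symmetric]) measurable
  also have "\<dots> \<le> (\<integral>\<^sup>+ \<omega>. ennreal (\<kappa>Gg\<^sup>2) * cond_E M g k (\<lambda>\<omega>'. (norm (s k \<omega>'))\<^sup>2) \<omega> \<partial>M)"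
    using dir_error by (rule nn_integral_mono_AE)
  also have "\<dots> = ennreal (\<kappa>Gg\<^sup>2) * (\<integral>\<^sup>+ \<omega>. cond_E M g k (\<lambda>\<omega>'. (norm (s k \<omega>'))\<^sup>2) \<omega> \<partial>M)"
    unfolding cond_E_def by (rule nn_integral_cmult) measurable
  finally show ?thesis
    by (subst (asm) nn_integral_cond_E) simp_all
qed

text \<open>The one-step decrease in expectation. All quantities are nonnegative and the negative term is moved
to the left-hand side, so that integrals in \<open>[0, \<infinity>]\<close> suffice and no integrability of \<open>f\<close> along the
iterates has to be shown. The hypothesis on the gradient error turns it into a multiple of the squared
step length, which joins the second-order terms in \<open>\<kappa>star\<close>.\<close>

lemma expected_gap_decrease:
  "(\<integral>\<^sup>+ \<omega>. ennreal (gap (Suc k) \<omega>) \<partial>M) + ennreal rate * (\<integral>\<^sup>+ \<omega>. ennreal (gain k \<omega>) \<partial>M)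
    \<le> (\<integral>\<^sup>+ \<omega>. ennreal (gap k \<omega>) \<partial>M) + ennreal \<kappa>star * (\<integral>\<^sup>+ \<omega>. ennreal (radius_sq k \<omega>) \<partial>M)"
proof -
  let ?err = "\<lambda>\<omega>. \<bar>(grad f (x k \<omega>) - g k \<omega>) \<bullet> s k \<omega>\<bar>"
  have "0 \<le> (\<kappa>B + L) / 2"
    using constants L_nonneg by simp
  have "(\<integral>\<^sup>+ \<omega>. ennreal (gap (Suc k) \<omega>) \<partial>M) + ennreal rate * (\<integral>\<^sup>+ \<omega>. ennreal (gain k \<omega>) \<partial>M)
    = (\<integral>\<^sup>+ \<omega>. ennreal (gap (Suc k) \<omega>) + ennreal rate * ennreal (gain k \<omega>) \<partial>M)"
    by (simp add: nn_integral_add nn_integral_cmult)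
  also have "\<dots> \<le> (\<integral>\<^sup>+ \<omega>. ennreal (gap k \<omega>) + ennreal (?err \<omega>)
    + ennreal ((\<kappa>B + L) / 2) * ennreal ((norm (s k \<omega>))\<^sup>2) \<partial>M)"
  proof (rule nn_integral_mono_AE)
    show "AE \<omega> in M. ennreal (gap (Suc k) \<omega>) + ennreal rate * ennreal (gain k \<omega>)
      \<le> ennreal (gap k \<omega>) + ennreal (?err \<omega>) + ennreal ((\<kappa>B + L) / 2) * ennreal ((norm (s k \<omega>))\<^sup>2)"
      using B_bound AE_space
    proof eventually_elim
      case (elim \<omega>)
      then have "gap (Suc k) \<omega> + rate * gain k \<omega>
        \<le> gap k \<omega> + ?err \<omega> + (\<kappa>B + L) / 2 * (norm (s k \<omega>))\<^sup>2"
        by (intro gap_decrease) simp_all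
      then have "ennreal (gap (Suc k) \<omega> + rate * gain k \<omega>)
        \<le> ennreal (gap k \<omega> + ?err \<omega> + (\<kappa>B + L) / 2 * (norm (s k \<omega>))\<^sup>2)"
        by (rule ennreal_leI)
      then show ?case
        using gap_nonneg[OF elim(2)] gain_nonneg[OF elim(2)] rate_pos \<open>0 \<le> (\<kappa>B + L) / 2\<close>
        by (simp only: ennreal_plus ennreal_mult add_nonneg_nonneg mult_nonneg_nonneg
            less_imp_le abs_ge_zero zero_le_power2)
    qed
  qed
  also have "\<dots> = (\<integral>\<^sup>+ \<omega>. ennreal (gap k \<omega>) \<partial>M) + ((\<integral>\<^sup>+ \<omega>. ennreal (?err \<omega>) \<partial>M)
    + ennreal ((\<kappa>B + L) / 2) * (\<integral>\<^sup>+ \<omega>. ennreal ((norm (s k \<omega>))\<^sup>2) \<partial>M))"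
    by (simp add: nn_integral_add nn_integral_cmult add.assoc)
  also have "\<dots> \<le> (\<integral>\<^sup>+ \<omega>. ennreal (gap k \<omega>) \<partial>M) + ennreal \<kappa>star * (\<integral>\<^sup>+ \<omega>. ennreal (radius_sq k \<omega>) \<partial>M)"
  proof (rule add_left_mono)
    have "(\<integral>\<^sup>+ \<omega>. ennreal (?err \<omega>) \<partial>M)
        + ennreal ((\<kappa>B + L) / 2) * (\<integral>\<^sup>+ \<omega>. ennreal ((norm (s k \<omega>))\<^sup>2) \<partial>M)
      \<le> (ennreal (\<kappa>Gg\<^sup>2) + ennreal ((\<kappa>B + L) / 2)) * (\<integral>\<^sup>+ \<omega>. ennreal ((norm (s k \<omega>))\<^sup>2) \<partial>M)"
      unfolding distrib_right by (intro add_right_mono expected_directional_error)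
    also have "\<dots> \<le> (ennreal (\<kappa>Gg\<^sup>2) + ennreal ((\<kappa>B + L) / 2))
      * (ennreal (\<kappa>s\<^sup>2) * (\<integral>\<^sup>+ \<omega>. ennreal (radius_sq k \<omega>) \<partial>M))"
    proof (rule mult_left_mono)
      have "(\<integral>\<^sup>+ \<omega>. ennreal ((norm (s k \<omega>))\<^sup>2) \<partial>M)
        \<le> (\<integral>\<^sup>+ \<omega>. ennreal (\<kappa>s\<^sup>2 * radius_sq k \<omega>) \<partial>M)"
        by (intro nn_integral_mono ennreal_leI norm_step_sq_le)
      also have "\<dots> = ennreal (\<kappa>s\<^sup>2) * (\<integral>\<^sup>+ \<omega>. ennreal (radius_sq k \<omega>) \<partial>M)"
        by (simp add: ennreal_mult' nn_integral_cmult)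
      finally show "(\<integral>\<^sup>+ \<omega>. ennreal ((norm (s k \<omega>))\<^sup>2) \<partial>M)
        \<le> ennreal (\<kappa>s\<^sup>2) * (\<integral>\<^sup>+ \<omega>. ennreal (radius_sq k \<omega>) \<partial>M)" .
    qed simp
    also have "\<dots> = ennreal \<kappa>star * (\<integral>\<^sup>+ \<omega>. ennreal (radius_sq k \<omega>) \<partial>M)"
    proof -
      have "(ennreal (\<kappa>Gg\<^sup>2) + ennreal ((\<kappa>B + L) / 2)) * ennreal (\<kappa>s\<^sup>2) = ennreal \<kappa>star"
        using \<open>0 \<le> (\<kappa>B + L) / 2\<close>
        by (simp add: kappa_star_def ennreal_mult[symmetric] ennreal_plus[symmetric] mult.commute
            del: ennreal_plus)
      then show ?thesis
        by (simp add: mult.assoc[symmetric])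
    qed
    finally show "(\<integral>\<^sup>+ \<omega>. ennreal (?err \<omega>) \<partial>M)
        + ennreal ((\<kappa>B + L) / 2) * (\<integral>\<^sup>+ \<omega>. ennreal ((norm (s k \<omega>))\<^sup>2) \<partial>M)
      \<le> ennreal \<kappa>star * (\<integral>\<^sup>+ \<omega>. ennreal (radius_sq k \<omega>) \<partial>M)" .
  qed
  finally show ?thesis .
qed

lemma expected_total_gain:
  "(\<integral>\<^sup>+ \<omega>. ennreal (gap (Suc k) \<omega>) \<partial>M)
      + ennreal rate * (\<Sum>j\<le>k. \<integral>\<^sup>+ \<omega>. ennreal (gain j \<omega>) \<partial>M)
    \<le> ennreal \<Gamma>0 + ennreal \<kappa>star * (\<Sum>j\<le>k. \<integral>\<^sup>+ \<omega>. ennreal (radius_sq j \<omega>) \<partial>M)"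
proof (induction k)
  case 0
  have "(\<integral>\<^sup>+ \<omega>. ennreal (gap 0 \<omega>) \<partial>M) = (\<integral>\<^sup>+ \<omega>. ennreal \<Gamma>0 \<partial>M)"
    by (intro nn_integral_cong) (simp add: run_simps(1))
  also have "\<dots> = ennreal \<Gamma>0"
    by (simp add: emeasure_space_1)
  finally show ?case
    using expected_gap_decrease[of 0] by simp
next
  case (Suc k)
  let ?gap = "\<lambda>k. \<integral>\<^sup>+ \<omega>. ennreal (gap k \<omega>) \<partial>M"
  let ?gain = "\<lambda>k. \<integral>\<^sup>+ \<omega>. ennreal (gain k \<omega>) \<partial>M"
  let ?rad = "\<lambda>k. \<integral>\<^sup>+ \<omega>. ennreal (radius_sq k \<omega>) \<partial>M"
  have "?gap (Suc (Suc k)) + ennreal rate * (\<Sum>j\<le>Suc k. ?gain j)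
    = (?gap (Suc (Suc k)) + ennreal rate * ?gain (Suc k)) + ennreal rate * (\<Sum>j\<le>k. ?gain j)"
    by (simp only: sum.atMost_Suc distrib_left ac_simps)
  also have "\<dots> \<le> (?gap (Suc k) + ennreal \<kappa>star * ?rad (Suc k)) + ennreal rate * (\<Sum>j\<le>k. ?gain j)"
    by (intro add_right_mono expected_gap_decrease)
  also have "\<dots> = (?gap (Suc k) + ennreal rate * (\<Sum>j\<le>k. ?gain j)) + ennreal \<kappa>star * ?rad (Suc k)"
    by (simp only: ac_simps)
  also have "\<dots> \<le> (ennreal \<Gamma>0 + ennreal \<kappa>star * (\<Sum>j\<le>k. ?rad j)) + ennreal \<kappa>star * ?rad (Suc k)"
    by (intro add_right_mono Suc.IH)
  also have "\<dots> = ennreal \<Gamma>0 + ennreal \<kappa>star * (\<Sum>j\<le>Suc k. ?rad j)"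
    by (simp only: sum.atMost_Suc distrib_left ac_simps)
  finally show ?case .
qed


lemma integrable_radius_sq: "integrable M (radius_sq k)"
  using radius_sq_le radius_sq_nonneg
  by (intro integrable_const_bound[where B = "real CARD('n)"]) (auto intro!: AE_I2)

lemma nn_integral_sum_radius_sq:
  "(\<Sum>j\<le>k. \<integral>\<^sup>+ \<omega>. ennreal (radius_sq j \<omega>) \<partial>M) = ennreal (\<Sum>j\<le>k. expectation (radius_sq j))"
proof -
  have "(\<integral>\<^sup>+ \<omega>. ennreal (radius_sq j \<omega>) \<partial>M) = ennreal (expectation (radius_sq j))" for j
    using integrable_radius_sq radius_sq_nonneg by (intro nn_integral_eq_integral) auto
  then show ?thesis
    using radius_sq_nonneg by (simp add: sum_ennreal integral_nonneg_AE AE_I2)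
qed

text \<open>The right-hand side of \<open>expected_total_gain\<close> is finite because the radii are bounded.\<close>

lemma integrable_gain: "integrable M (gain k)"
proof (rule integrableI_nonneg)
  have "ennreal rate * (\<integral>\<^sup>+ \<omega>. ennreal (gain k \<omega>) \<partial>M)
    \<le> ennreal rate * (\<Sum>j\<le>k. \<integral>\<^sup>+ \<omega>. ennreal (gain j \<omega>) \<partial>M)"
    by (intro mult_left_mono member_le_sum) simp_all
  also have "\<dots> \<le> (\<integral>\<^sup>+ \<omega>. ennreal (gap (Suc k) \<omega>) \<partial>M)
      + ennreal rate * (\<Sum>j\<le>k. \<integral>\<^sup>+ \<omega>. ennreal (gain j \<omega>) \<partial>M)"
    by simp
  also have "\<dots> \<le> ennreal \<Gamma>0 + ennreal \<kappa>star * ennreal (\<Sum>j\<le>k. expectation (radius_sq j))"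
    using expected_total_gain by (simp only: nn_integral_sum_radius_sq)
  also have "\<dots> < \<infinity>"
    by (simp add: ennreal_mult_less_top)
  finally show "(\<integral>\<^sup>+ \<omega>. ennreal (gain k \<omega>) \<partial>M) < \<infinity>"
    using rate_pos by (auto simp: ennreal_mult_less_top)
qed (auto intro: gain_nonneg AE_I2)

lemma expectation_total_gain:
  assumes "0 \<le> \<Gamma>0"
  shows "rate * (\<Sum>j\<le>k. expectation (gain j))
    \<le> \<Gamma>0 + \<kappa>star * (\<Sum>j\<le>k. expectation (radius_sq j))"
proof -
  have gain: "(\<integral>\<^sup>+ \<omega>. ennreal (gain j \<omega>) \<partial>M) = ennreal (expectation (gain j))" for j
    using integrable_gain gain_nonneg by (intro nn_integral_eq_integral) auto
  have gain_nonneg': "0 \<le> expectation (gain j)" for j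
    using gain_nonneg by (intro integral_nonneg_AE AE_I2)
  have radius_sq_nonneg': "0 \<le> expectation (radius_sq j)" for j
    using radius_sq_nonneg by (intro integral_nonneg_AE AE_I2)
  have "ennreal (rate * (\<Sum>j\<le>k. expectation (gain j)))
    = ennreal rate * (\<Sum>j\<le>k. \<integral>\<^sup>+ \<omega>. ennreal (gain j \<omega>) \<partial>M)"
    using rate_pos gain_nonneg' by (simp only: gain sum_ennreal ennreal_mult' less_imp_le)
  also have "\<dots> \<le> (\<integral>\<^sup>+ \<omega>. ennreal (gap (Suc k) \<omega>) \<partial>M)
      + ennreal rate * (\<Sum>j\<le>k. \<integral>\<^sup>+ \<omega>. ennreal (gain j \<omega>) \<partial>M)"
    by simp
  also have "\<dots> \<le> ennreal \<Gamma>0 + ennreal \<kappa>star * ennreal (\<Sum>j\<le>k. expectation (radius_sq j))"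
    using expected_total_gain by (simp only: nn_integral_sum_radius_sq)
  also have "\<dots> = ennreal (\<Gamma>0 + \<kappa>star * (\<Sum>j\<le>k. expectation (radius_sq j)))"
  proof -
    have "0 \<le> \<kappa>star" "0 \<le> (\<Sum>j\<le>k. expectation (radius_sq j))"
      using \<kappa>star_ge radius_sq_nonneg' by (simp_all add: sum_nonneg)
    then show ?thesis
      using assms by (simp only: ennreal_plus ennreal_mult mult_nonneg_nonneg)
  qed
  finally show ?thesis
    using assms \<kappa>star_ge radius_sq_nonneg' by (subst (asm) ennreal_le_iff) (simp_all add: sum_nonneg)
qed

lemma integrable_weight_sum: "integrable M (weight_sum k)"
proof (rule Bochner_Integration.integrable_bound)
  show "integrable M (\<lambda>\<omega>. real CARD('n) * sqrt \<sigma> + (\<Sum>j\<le>k. gain j \<omega>))"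
    by (intro Bochner_Integration.integrable_add Bochner_Integration.integrable_sum integrable_const
        integrable_gain)
  show "AE \<omega> in M. norm (weight_sum k \<omega>)
    \<le> norm (real CARD('n) * sqrt \<sigma> + (\<Sum>j\<le>k. gain j \<omega>))"
  proof (rule AE_I2)
    fix \<omega>
    assume "\<omega> \<in> space M"
    from weight_sum_le[OF this, of k] weight_sum_nonneg[OF this, of k]
    show "norm (weight_sum k \<omega>) \<le> norm (real CARD('n) * sqrt \<sigma> + (\<Sum>j\<le>k. gain j \<omega>))"
      by simp
  qed
qed measurable

section \<open>Weights and projected gradients in expectation\<close>

text \<open>The gain grows at least like the weights, the radii grow at most like their logarithm. The tangent
slope \<open>a\<close> is chosen such that \<open>2 * \<kappa>star * a\<close> is half of \<open>rate\<close>: half of the gain absorbs the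
linear part of the logarithmic bound, and the other half bounds the weights.\<close>

lemma expectation_weight_sum_le:
  assumes "0 \<le> \<Gamma>0"
  shows "expectation (weight_sum k) \<le> kappa_conv (real CARD('n)) \<sigma> \<tau> \<kappa>B \<kappa>star \<Gamma>0"
proof (rule weight_le_kappa_conv)
  define n where "n = real CARD('n)"
  define a where "a = rate / (4 * \<kappa>star)"
  define N where "N = n * \<tau> * \<sigma> / (2 * \<kappa>B)"
  define T where "T = 2 * n * \<kappa>star * (ln (8 * \<kappa>star * \<kappa>B / (\<tau> * \<sigma>)) - 1)"
  let ?W = "expectation (weight_sum k)"
  let ?D = "\<Sum>j\<le>k. expectation (gain j)"
  let ?V = "\<Sum>j\<le>k. expectation (radius_sq j)"
  have "0 < \<kappa>star"
    using \<kappa>star_ge by linarith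
  then have "0 < a"
    unfolding a_def using rate_pos by simp
  have "?W \<le> expectation (\<lambda>\<omega>. n * sqrt \<sigma> + (\<Sum>j\<le>k. gain j \<omega>))"
    unfolding n_def
    by (intro integral_mono weight_sum_le integrable_weight_sum Bochner_Integration.integrable_add
        Bochner_Integration.integrable_sum integrable_const integrable_gain)
  then have W: "?W \<le> n * sqrt \<sigma> + ?D"
    by (simp add: integrable_gain prob_space)
  have "expectation (\<lambda>\<omega>. \<Sum>j\<le>k. radius_sq j \<omega>)
    \<le> expectation (\<lambda>\<omega>. 2 * (a * weight_sum k \<omega> + n * (ln (1 / (a * sqrt \<sigma>)) - 1)))"
    unfolding n_def using \<open>0 < a\<close>
    by (intro integral_mono sum_radius_sq_le Bochner_Integration.integrable_sum integrable_radius_sq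
        integrable_mult_right Bochner_Integration.integrable_add integrable_const integrable_weight_sum)
  then have "?V \<le> 2 * (a * ?W + n * (ln (1 / (a * sqrt \<sigma>)) - 1))"
    by (simp add: integrable_radius_sq integrable_weight_sum prob_space)
  then have "\<kappa>star * ?V \<le> \<kappa>star * (2 * (a * ?W + n * (ln (1 / (a * sqrt \<sigma>)) - 1)))"
    using \<open>0 < \<kappa>star\<close> by (intro mult_left_mono) simp_all
  also have "\<dots> = rate / 2 * ?W + 2 * n * \<kappa>star * (ln (1 / (a * sqrt \<sigma>)) - 1)"
  proof -
    have "rate = 4 * \<kappa>star * a"
      unfolding a_def using \<open>0 < \<kappa>star\<close> by simp
    then show ?thesis
      by (simp add: algebra_simps)
  qed
  also have "1 / (a * sqrt \<sigma>) = 8 * \<kappa>star * \<kappa>B / (\<tau> * \<sigma>)"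
    unfolding a_def rate_def using constants by (simp add: field_simps)
  finally have V: "\<kappa>star * ?V \<le> rate / 2 * ?W + T"
    by (simp only: T_def)
  have "rate * ?W \<le> rate * (n * sqrt \<sigma> + ?D)"
    using W rate_pos by (intro mult_left_mono) simp_all
  also have "\<dots> = N + rate * ?D"
    using constants by (simp add: N_def rate_def distrib_left)
  also have "\<dots> \<le> N + (\<Gamma>0 + \<kappa>star * ?V)"
    using expectation_total_gain[OF assms] by (rule add_left_mono)
  finally have "rate / 2 * ?W \<le> N + \<Gamma>0 + T"
    using V by simp
  then show "\<tau> * sqrt \<sigma> / (4 * \<kappa>B) * ?W
    \<le> real CARD('n) * \<tau> * \<sigma> / (2 * \<kappa>B) + \<Gamma>0
      + 2 * real CARD('n) * \<kappa>star * (ln (8 * \<kappa>star * \<kappa>B / (\<tau> * \<sigma>)) - 1)"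
    by (simp add: n_def N_def T_def rate_def)
qed (use constants \<kappa>star_ge assms in \<open>simp_all add: Suc_leI\<close>)

lemma norm_d_le_weight_sum:
  assumes "\<omega> \<in> space M"
  shows "norm (d k \<omega>) \<le> weight_sum k \<omega>"
proof -
  have "(\<Sum>i\<in>UNIV. \<bar>d k \<omega> $ i\<bar>) \<le> weight_sum k \<omega>"
    unfolding weight_sum_def by (intro sum_mono adagrad_weights.abs_le_w[OF weights] assms)
  then show ?thesis
    using norm_le_l1_cart[of "d k \<omega>"] by linarith
qed

lemma integrable_norm_d: "integrable M (\<lambda>\<omega>. norm (d k \<omega>))"
proof (rule Bochner_Integration.integrable_bound[OF integrable_weight_sum])
  show "AE \<omega> in M. norm (norm (d k \<omega>)) \<le> norm (weight_sum k \<omega>)"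
    using norm_d_le_weight_sum by (intro AE_I2) (simp add: weight_sum_nonneg)
qed measurable

lemma expectation_sum_norm_d_le:
  assumes "0 \<le> \<Gamma>0"
  shows "(\<Sum>j\<le>k. expectation (\<lambda>\<omega>. norm (d j \<omega>)))
    \<le> sqrt (real k + 1) * kappa_conv (real CARD('n)) \<sigma> \<tau> \<kappa>B \<kappa>star \<Gamma>0"
proof -
  have "expectation (\<lambda>\<omega>. \<Sum>j\<le>k. norm (d j \<omega>)) \<le> expectation (\<lambda>\<omega>. sqrt (real k + 1) * weight_sum k \<omega>)"
    unfolding weight_sum_def
    by (intro integral_mono sum_norm_le_weights[OF weights] Bochner_Integration.integrable_sum
        integrable_norm_d integrable_mult_right integrable_weight_sum[unfolded weight_sum_def[abs_def]])
  also have "\<dots> = sqrt (real k + 1) * expectation (weight_sum k)"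
    by simp
  also have "\<dots> \<le> sqrt (real k + 1) * kappa_conv (real CARD('n)) \<sigma> \<tau> \<kappa>B \<kappa>star \<Gamma>0"
    using assms by (intro mult_left_mono expectation_weight_sum_le) simp_all
  finally show ?thesis
    by (simp add: integrable_norm_d)
qed

section \<open>From the computed to the exact projected gradient\<close>

lemma expected_gradient_error:
  assumes "0 \<le> \<kappa>err"
    and rmse: "AE \<omega> in M. RMSE M g (\<lambda>k \<omega>. grad f (x k \<omega>)) k \<omega>
      \<le> ennreal \<kappa>err * cond_E M g k (\<lambda>\<omega>'. norm (d k \<omega>')) \<omega>"
  shows "(\<integral>\<^sup>+ \<omega>. ennreal (norm (g k \<omega> - grad f (x k \<omega>))) \<partial>M)
    \<le> ennreal (\<kappa>err * expectation (\<lambda>\<omega>. norm (d k \<omega>)))"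
proof -
  interpret past: sigma_finite_subalgebra M "past M g k"
    by (rule past_sigma_finite)
  have "(\<integral>\<^sup>+ \<omega>. ennreal (norm (g k \<omega> - grad f (x k \<omega>))) \<partial>M)
    \<le> (\<integral>\<^sup>+ \<omega>. ennreal \<kappa>err * cond_E M g k (\<lambda>\<omega>'. norm (d k \<omega>')) \<omega> \<partial>M)"
  proof (rule past.nn_integral_le_conditional_rms)
    show "prob_space M"
      by (rule prob_space_axioms)
    show "(\<lambda>\<omega>. ennreal \<kappa>err * cond_E M g k (\<lambda>\<omega>'. norm (d k \<omega>')) \<omega>) \<in> borel_measurable (past M g k)"
      unfolding cond_E_def by measurable
    show "AE \<omega> in M. nn_cond_exp M (past M g k)
        (\<lambda>\<omega>. (ennreal (norm (g k \<omega> - grad f (x k \<omega>))))\<^sup>2) \<omega>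
      \<le> (ennreal \<kappa>err * cond_E M g k (\<lambda>\<omega>'. norm (d k \<omega>')) \<omega>)\<^sup>2"
      using rmse unfolding RMSE_def ennreal_sqrt_le_iff by (simp add: cond_E_def ennreal_power)
  qed measurable
  also have "\<dots> = ennreal \<kappa>err * (\<integral>\<^sup>+ \<omega>. cond_E M g k (\<lambda>\<omega>'. norm (d k \<omega>')) \<omega> \<partial>M)"
    unfolding cond_E_def by (rule nn_integral_cmult) measurable
  also have "(\<integral>\<^sup>+ \<omega>. cond_E M g k (\<lambda>\<omega>'. norm (d k \<omega>')) \<omega> \<partial>M) = ennreal (expectation (\<lambda>\<omega>. norm (d k \<omega>)))"
    by (simp add: nn_integral_cond_E nn_integral_eq_integral integrable_norm_d)
  finally show ?thesis
    using assms by (simp add: ennreal_mult')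
qed

text \<open>Projections are nonexpansive, so the exact and the computed projected gradients differ by at most
the gradient error.\<close>

lemma expectation_criticality_le:
  assumes "0 \<le> \<kappa>err"
    and "AE \<omega> in M. RMSE M g (\<lambda>k \<omega>. grad f (x k \<omega>)) k \<omega>
      \<le> ennreal \<kappa>err * cond_E M g k (\<lambda>\<omega>'. norm (d k \<omega>')) \<omega>"
  defines "\<Xi> \<equiv> \<lambda>\<omega>. closest_point (box_set l u) (x k \<omega> - grad f (x k \<omega>)) - x k \<omega>"
  shows "expectation (\<lambda>\<omega>. norm (\<Xi> \<omega>)) \<le> (1 + \<kappa>err) * expectation (\<lambda>\<omega>. norm (d k \<omega>))"
proof -
  let ?d = "expectation (\<lambda>\<omega>. norm (d k \<omega>))"
  have "norm (\<Xi> \<omega>) \<le> norm (d k \<omega>) + norm (g k \<omega> - grad f (x k \<omega>))" if "\<omega> \<in> space M" for \<omega>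
  proof -
    have "\<Xi> \<omega> = d k \<omega> + (closest_point (box_set l u) (x k \<omega> - grad f (x k \<omega>))
      - closest_point (box_set l u) (x k \<omega> - g k \<omega>))"
      by (simp add: \<Xi>_def run_simps(2)[OF that])
    also have "norm \<dots> \<le> norm (d k \<omega>) + dist (closest_point (box_set l u) (x k \<omega> - grad f (x k \<omega>)))
      (closest_point (box_set l u) (x k \<omega> - g k \<omega>))"
      unfolding dist_norm by (rule norm_triangle_ineq)
    also have "\<dots> \<le> norm (d k \<omega>) + dist (x k \<omega> - grad f (x k \<omega>)) (x k \<omega> - g k \<omega>)"
      using closest_point_lipschitz[OF closed_convex_box_set(2,1) nonempty] by (rule add_left_mono)
    finally show ?thesis
      by (simp add: dist_norm)
  qed
  then have "(\<integral>\<^sup>+ \<omega>. ennreal (norm (\<Xi> \<omega>)) \<partial>M)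
    \<le> (\<integral>\<^sup>+ \<omega>. ennreal (norm (d k \<omega>)) + ennreal (norm (g k \<omega> - grad f (x k \<omega>))) \<partial>M)"
    by (intro nn_integral_mono) (simp add: ennreal_plus[symmetric] ennreal_leI del: ennreal_plus)
  also have "\<dots> = (\<integral>\<^sup>+ \<omega>. ennreal (norm (d k \<omega>)) \<partial>M)
    + (\<integral>\<^sup>+ \<omega>. ennreal (norm (g k \<omega> - grad f (x k \<omega>))) \<partial>M)"
    by (intro nn_integral_add) measurable
  also have "\<dots> \<le> ennreal ?d + ennreal (\<kappa>err * ?d)"
    using expected_gradient_error[OF assms(1,2)]
    by (simp add: nn_integral_eq_integral integrable_norm_d add_left_mono)
  also have "\<dots> = ennreal ((1 + \<kappa>err) * ?d)"
    using assms by (simp add: ennreal_plus[symmetric] distrib_right del: ennreal_plus)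
  finally have "enn2real (\<integral>\<^sup>+ \<omega>. ennreal (norm (\<Xi> \<omega>)) \<partial>M) \<le> (1 + \<kappa>err) * ?d"
    using assms by (intro enn2real_leI) simp_all
  moreover have "\<Xi> \<in> borel_measurable M"
    unfolding \<Xi>_def by measurable
  ultimately show ?thesis
    by (subst integral_eq_nn_integral) simp_all
qed

end

section \<open>The convergence rate\<close>

theorem corollary4p3:
  fixes M :: "'w measure"
    and f :: "real ^ 'n \<Rightarrow> real"
    and l u :: "ereal ^ 'n"
    and x_ini :: "real ^ 'n"
    and x g d w \<Delta> s G \<Xi> :: "nat \<Rightarrow> 'w \<Rightarrow> real ^ 'n"
    and B :: "nat \<Rightarrow> 'w \<Rightarrow> real ^ 'n ^ 'n"
    and U :: "(real ^ 'n) set"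
    and \<sigma> \<tau> \<kappa>s L \<kappa>B f_low \<kappa>Gg \<kappa>err :: real
  assumes "prob_space M"
    and "0 < \<sigma>" "\<sigma> \<le> 1" "0 < \<tau>" "\<tau> \<le> 1" "1 \<le> \<kappa>s"
    and run: "\<And>\<omega>. \<omega> \<in> space M \<Longrightarrow>
      adagb2_run l u \<sigma> \<tau> \<kappa>s x_ini (\<lambda>k. x k \<omega>) (\<lambda>k. g k \<omega>) (\<lambda>k. d k \<omega>) (\<lambda>k. w k \<omega>)
        (\<lambda>k. \<Delta> k \<omega>) (\<lambda>k. B k \<omega>) (\<lambda>k. s k \<omega>)"
    and measurable: "\<And>k. g k \<in> borel_measurable M" "\<And>k. B k \<in> borel_measurable M"
      "\<And>k. s k \<in> borel_measurable M"
    and adapted: "\<And>k. x k \<in> borel_measurable (past M g k)"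
    and G: "\<And>k \<omega>. G k \<omega> = grad f (x k \<omega>)"
    and Xi: "\<And>k \<omega>. \<Xi> k \<omega> = closest_point (box_set l u) (x k \<omega> - G k \<omega>) - x k \<omega>"
    and nonempty: "box_set l u \<noteq> {}"
    and smooth: "open U" "box_set l u \<subseteq> U" "twice_cont_diff_on f U"
    and lipschitz: "\<And>y. f differentiable (at y)" "L-lipschitz_on UNIV (grad f)"
    and "1 \<le> \<kappa>B"
    and B_bound: "AE \<omega> in M. \<forall>k. onorm ((*v) (B k \<omega>)) \<le> \<kappa>B"
    and "f_low < f (closest_point (box_set l u) x_ini)"
    and f_low: "\<And>y. y \<in> box_set l u \<Longrightarrow> f_low \<le> f y"
    and "0 < \<kappa>Gg"
    and dir_error: "\<And>k. AE \<omega> in M.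
      cond_E M g k (\<lambda>\<omega>'. \<bar>(G k \<omega>' - g k \<omega>') \<bullet> s k \<omega>'\<bar>) \<omega>
        \<le> ennreal (\<kappa>Gg\<^sup>2) * cond_E M g k (\<lambda>\<omega>'. (norm (s k \<omega>'))\<^sup>2) \<omega>"
    and "0 \<le> \<kappa>err"
    and rmse: "\<And>k. AE \<omega> in M.
      RMSE M g G k \<omega> \<le> ennreal \<kappa>err * cond_E M g k (\<lambda>\<omega>'. norm (d k \<omega>')) \<omega>"
  shows "\<forall>k. 1 / (real k + 1) * (\<Sum>j=0..k. prob_space.expectation M (\<lambda>\<omega>. norm (\<Xi> j \<omega>)))
    \<le> (1 + \<kappa>err) *
      kappa_conv (real CARD('n)) \<sigma> \<tau> \<kappa>B (kappa_star \<kappa>s \<kappa>Gg \<kappa>B L)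
        (f (closest_point (box_set l u) x_ini) - f_low) / sqrt (real k + 1)"
proof
  fix k
  have G_eq: "G = (\<lambda>k \<omega>. grad f (x k \<omega>))"
    using G by (intro ext)
  interpret adagb2_process M f l u x_ini x g d w \<Delta> s B \<sigma> \<tau> \<kappa>s L \<kappa>B f_low \<kappa>Gg
    by (intro adagb2_process.intro adagb2_process_axioms.intro)
      (fact assms dir_error[unfolded G_eq])+
  define K where "K = kappa_conv (real CARD('n)) \<sigma> \<tau> \<kappa>B (kappa_star \<kappa>s \<kappa>Gg \<kappa>B L)
    (f (closest_point (box_set l u) x_ini) - f_low)"
  have "(\<Sum>j=0..k. expectation (\<lambda>\<omega>. norm (\<Xi> j \<omega>)))
    \<le> (\<Sum>j\<le>k. (1 + \<kappa>err) * expectation (\<lambda>\<omega>. norm (d j \<omega>)))"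
    unfolding Xi G atLeast0AtMost
    by (intro sum_mono expectation_criticality_le \<open>0 \<le> \<kappa>err\<close> rmse[unfolded G_eq])
  also have "\<dots> = (1 + \<kappa>err) * (\<Sum>j\<le>k. expectation (\<lambda>\<omega>. norm (d j \<omega>)))"
    by (rule sum_distrib_left[symmetric])
  also have "\<dots> \<le> (1 + \<kappa>err) * (sqrt (real k + 1) * K)"
    unfolding K_def using \<open>0 \<le> \<kappa>err\<close> \<open>f_low < _\<close>
    by (intro mult_left_mono expectation_sum_norm_d_le) simp_all
  finally have "1 / (real k + 1) * (\<Sum>j=0..k. expectation (\<lambda>\<omega>. norm (\<Xi> j \<omega>)))
    \<le> 1 / (real k + 1) * ((1 + \<kappa>err) * (sqrt (real k + 1) * K))"
    by (rule mult_left_mono) simp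
  also have "\<dots> = (1 + \<kappa>err) * K * (sqrt (real k + 1) / (real k + 1))"
    by simp
  also have "sqrt (real k + 1) / (real k + 1) = 1 / sqrt (real k + 1)"
    using real_div_sqrt[of "real k + 1"] by (simp add: field_simps)
  finally show "1 / (real k + 1) * (\<Sum>j=0..k. expectation (\<lambda>\<omega>. norm (\<Xi> j \<omega>)))
    \<le> (1 + \<kappa>err) * kappa_conv (real CARD('n)) \<sigma> \<tau> \<kappa>B (kappa_star \<kappa>s \<kappa>Gg \<kappa>B L)
      (f (closest_point (box_set l u) x_ini) - f_low) / sqrt (real k + 1)"
    by (simp add: K_def)
qed

end
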